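(* Let $0<b_1<b_2<1$ and let $\delta_{\mathbf 1_{x>0}}$ be the Dirac measure on the configuration $\eta(x)=\mathbf 1_{x>0}$. For any finite sequence of integers $k_1,\dots,k_n$, the measure $$\prod_{i=1}^n P_{k_i}\,\delta_{\mathbf 1_{x>0}}$$ is stochastically dominated by the blocking measure $\pi$.
   Context: Particle configurations are maps $\eta:\mathbb Z\to\{0,1\}$. For $k\in\mathbb Z$, $\eta^k$ is the configuration obtained from $\eta$ by swapping the values $\eta(k)$ and $\eta(k+1)$. $P_k$ is the Markov operator acting linearly on measures on configurations by $$P_k\delta_\eta=\begin{cases}(1-b_1)\delta_\eta+b_1\delta_{\eta^k},&(\eta(k),\eta(k+1))=(0,1)\\(1-b_2)\delta_\eta+b_2\delta_{\eta^k},&(\eta(k),\eta(k+1))=(1,0)\\ \delta_\eta,&\eta(k)=\eta(k+1).\end{cases}$$ Products of operators are applied from right to left. Let $A=\{\eta:\mathbb Z\to\{0,1\}:\sum_{x\le 0}\eta(x)=\sum_{x\ge1}(1-\eta(x))<\infty\}$. With $q=b_1/b_2\in(0,1)$, let $\hat\pi=\bigotimes_{x\in\mathbb Z}\mathrm{Ber}\!\left(\frac{q^{-x}}{1+q^{-x}}\right)$; the blocking measure is $\pi(\cdot)=\hat\pi(\cdot\mid A)$. For $\eta\in A$ the height function $h_\eta:\mathbb Z\to\mathbb Z$ is defined by $\lim_{x\to-\infty}h_\eta(x)=0$ and $h_\eta(x+1)-h_\eta(x)=\eta(x)$. For probability measures $\mu,\nu$ on $A$, $\mu$ stochastically dominates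 $\nu$ ($\nu\preceq\mu$) if there is a coupling $(\eta,\xi)$ with $\eta\sim\mu$, $\xi\sim\nu$ such that $h_\xi(x)\le h_\eta(x)$ for all $x$. *)

theory Defs
  imports "HOL-Probability.Probability"
begin

text \<open>A configuration \<open>\<int> \<rightarrow> {0,1}\<close> is a Boolean function; \<open>\<eta> x\<close> says that site \<open>x\<close> is occupied.\<close>

type_synonym config = "int \<Rightarrow> bool"

definition config_space :: "config measure" where
  "config_space = (\<Pi>\<^sub>M x\<in>UNIV. count_space UNIV)"

definition swap_config :: "int \<Rightarrow> config \<Rightarrow> config" where
  "swap_config k \<eta> = \<eta>(k := \<eta> (k + 1), k + 1 := \<eta> k)"

definition swap_rate :: "real \<Rightarrow> real \<Rightarrow> int \<Rightarrow> config \<Rightarrow> real" where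
  "swap_rate b1 b2 k \<eta> =
     (if \<not> \<eta> k \<and> \<eta> (k + 1) then b1 else if \<eta> k \<and> \<not> \<eta> (k + 1) then b2 else 0)"

text \<open>\<open>P\<^sub>k \<delta>\<^sub>\<eta>\<close>, written as the law of the configuration obtained by swapping when a Bernoulli
  coin shows heads; the lemma \<open>emeasure_step_kernel\<close> below gives it as a mixture of two
  Dirac measures.\<close>

definition step_kernel :: "real \<Rightarrow> real \<Rightarrow> int \<Rightarrow> config \<Rightarrow> config measure" where
  "step_kernel b1 b2 k \<eta> =
     distr (measure_pmf (bernoulli_pmf (swap_rate b1 b2 k \<eta>))) config_space
       (\<lambda>s. if s then swap_config k \<eta> else \<eta>)"

definition markov_op :: "real \<Rightarrow> real \<Rightarrow> int \<Rightarrow> config measure \<Rightarrow> config measure" where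
  "markov_op b1 b2 k \<mu> = \<mu> \<bind> step_kernel b1 b2 k"

definition A_set :: "config set" where
  "A_set = {\<eta>. (\<Sum>\<^sub>\<infinity>x\<in>{..0}. of_bool (\<eta> x) :: ennreal) = (\<Sum>\<^sub>\<infinity>x\<in>{1..}. 1 - of_bool (\<eta> x))
             \<and> (\<Sum>\<^sub>\<infinity>x\<in>{1..}. 1 - of_bool (\<eta> x) :: ennreal) < \<infinity>}"

definition product_blocking_measure :: "real \<Rightarrow> config measure" where
  "product_blocking_measure q =
     (\<Pi>\<^sub>M x\<in>UNIV. measure_pmf (bernoulli_pmf (q powi (- x) / (1 + q powi (- x)))))"

text \<open>\<open>uniform_measure M A\<close> is the conditional measure \<open>B \<mapsto> M (A \<inter> B) / M A\<close>.\<close>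

definition blocking_measure :: "real \<Rightarrow> config measure" where
  "blocking_measure q = uniform_measure (product_blocking_measure q) A_set"

definition height :: "config \<Rightarrow> int \<Rightarrow> int" where
  "height \<eta> = (THE h. (h \<longlongrightarrow> 0) at_bot \<and> (\<forall>x. h (x + 1) - h x = of_bool (\<eta> x)))"

text \<open>Probability measures on \<open>A\<close> are represented as probability measures on all
  configurations that are concentrated on \<open>A\<close>.\<close>

definition prob_on_A :: "config measure \<Rightarrow> bool" where
  "prob_on_A \<mu> \<longleftrightarrow> prob_space \<mu> \<and> sets \<mu> = sets config_space \<and> (AE \<eta> in \<mu>. \<eta> \<in> A_set)"

definition stoch_dominated :: "config measure \<Rightarrow> config measure \<Rightarrow> bool"  (infix "\<preceq>" 50) where
  "\<nu> \<preceq> \<mu> \<longleftrightarrow> prob_on_A \<nu> \<and> prob_on_A \<mu> \<and>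
     (\<exists>\<Gamma>. prob_space \<Gamma> \<and> sets \<Gamma> = sets (config_space \<Otimes>\<^sub>M config_space) \<and>
          distr \<Gamma> config_space fst = \<mu> \<and> distr \<Gamma> config_space snd = \<nu> \<and>
          (AE (\<eta>, \<xi>) in \<Gamma>. \<forall>x. height \<xi> x \<le> height \<eta> x))"

lemma space_config_space [simp]: "space config_space = UNIV"
  by (simp add: config_space_def space_PiM)

lemma measurable_config_coord [measurable]: "(\<lambda>\<eta>. \<eta> x) \<in> config_space \<rightarrow>\<^sub>M count_space UNIV"
  unfolding config_space_def by simp

lemma measurable_swap_config [measurable]: "swap_config k \<in> config_space \<rightarrow>\<^sub>M config_space"
proof -
  have "(\<lambda>\<eta> x. swap_config k \<eta> x) \<in> config_space \<rightarrow>\<^sub>M (\<Pi>\<^sub>M x\<in>UNIV. count_space UNIV)"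
  proof (rule measurable_PiM_single')
    fix x :: int
    consider "x = k" | "x = k + 1" | "x \<noteq> k" "x \<noteq> k + 1" by blast
    then show "(\<lambda>\<eta>. swap_config k \<eta> x) \<in> config_space \<rightarrow>\<^sub>M count_space UNIV"
      by cases (auto simp: swap_config_def)
  qed auto
  then show ?thesis by (simp add: config_space_def)
qed

lemma measurable_swap_rate [measurable]: "swap_rate b1 b2 k \<in> borel_measurable config_space"
  unfolding swap_rate_def by measurable

lemma emeasure_step_kernel:
  assumes "0 \<le> b1" "b1 \<le> 1" "0 \<le> b2" "b2 \<le> 1" and S: "S \<in> sets config_space"
  shows "emeasure (step_kernel b1 b2 k \<eta>) S =
     (if \<not> \<eta> k \<and> \<eta> (k + 1) then ennreal (1 - b1) * indicator S \<eta> + ennreal b1 * indicator S (swap_config k \<eta>)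
      else if \<eta> k \<and> \<not> \<eta> (k + 1) then ennreal (1 - b2) * indicator S \<eta> + ennreal b2 * indicator S (swap_config k \<eta>)
      else indicator S \<eta>)"
proof -
  let ?p = "swap_rate b1 b2 k \<eta>" and ?g = "\<lambda>s. if s then swap_config k \<eta> else \<eta>"
  have p: "0 \<le> ?p" "?p \<le> 1" using assms by (auto simp: swap_rate_def)
  have "emeasure (step_kernel b1 b2 k \<eta>) S = (\<integral>\<^sup>+ s. indicator S (?g s) \<partial>measure_pmf (bernoulli_pmf ?p))"
    unfolding step_kernel_def using S
    by (subst nn_integral_indicator[symmetric], simp, subst nn_integral_distr) auto
  also have "\<dots> = ennreal (1 - ?p) * indicator S \<eta> + ennreal ?p * indicator S (swap_config k \<eta>)"
    using p by (simp add: nn_integral_measure_pmf_support[of UNIV] UNIV_bool mult.commute add.commute)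
  finally show ?thesis by (auto simp: swap_rate_def)
qed

lemma prob_space_step_kernel: "prob_space (step_kernel b1 b2 k \<eta>)"
  unfolding step_kernel_def by (rule measure_pmf.prob_space_distr) auto

lemma measurable_step_kernel:
  assumes "0 \<le> b1" "b1 \<le> 1" "0 \<le> b2" "b2 \<le> 1"
  shows "step_kernel b1 b2 k \<in> config_space \<rightarrow>\<^sub>M subprob_algebra config_space"
proof (rule measurable_subprob_algebra)
  show "subprob_space (step_kernel b1 b2 k \<eta>)" for \<eta>
    by (rule prob_space_imp_subprob_space[OF prob_space_step_kernel])
  show "sets (step_kernel b1 b2 k \<eta>) = sets config_space" for \<eta>
    by (simp add: step_kernel_def)
  fix S assume S [measurable]: "S \<in> sets config_space"
  show "(\<lambda>\<eta>. emeasure (step_kernel b1 b2 k \<eta>) S) \<in> borel_measurable config_space"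
    unfolding emeasure_step_kernel[OF assms S] by measurable
qed

lemma markov_op_return:
  assumes "0 \<le> b1" "b1 \<le> 1" "0 \<le> b2" "b2 \<le> 1"
  shows "markov_op b1 b2 k (return config_space \<eta>) = step_kernel b1 b2 k \<eta>"
  unfolding markov_op_def by (rule bind_return[OF measurable_step_kernel[OF assms]]) simp

lemma emeasure_markov_op:
  assumes "0 \<le> b1" "b1 \<le> 1" "0 \<le> b2" "b2 \<le> 1"
    and "sets \<mu> = sets config_space" and "S \<in> sets config_space"
  shows "emeasure (markov_op b1 b2 k \<mu>) S = (\<integral>\<^sup>+ \<eta>. emeasure (step_kernel b1 b2 k \<eta>) S \<partial>\<mu>)"
proof -
  have sp: "space \<mu> = UNIV" using sets_eq_imp_space_eq[OF assms(5)] by simp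
  have "step_kernel b1 b2 k \<in> \<mu> \<rightarrow>\<^sub>M subprob_algebra config_space"
    using measurable_step_kernel[OF assms(1-4)] measurable_cong_sets[OF assms(5) refl] by blast
  from emeasure_bind[OF _ this assms(6)] sp show ?thesis unfolding markov_op_def by simp
qed

lemma infsum_of_bool_ennreal:
  "(\<Sum>\<^sub>\<infinity>x\<in>S. of_bool (P x) :: ennreal) =
     (if finite {x\<in>S. P x} then of_nat (card {x\<in>S. P x}) else \<infinity>)"
proof -
  have eq: "(\<Sum>\<^sub>\<infinity>x\<in>S. of_bool (P x) :: ennreal) = (\<Sum>\<^sub>\<infinity>x\<in>{x\<in>S. P x}. 1)"
    by (rule infsum_cong_neutral) auto
  show ?thesis
  proof (cases "finite {x\<in>S. P x}")
    case True then show ?thesis by (simp add: eq)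
  next
    case False
    then have "(\<Sum>\<^sub>\<infinity>x\<in>{x\<in>S. P x}. 1 :: ennreal) = \<infinity>"
      by (intro infsum_superconst_infinite_ennreal[where b = 1]) auto
    with False eq show ?thesis by simp
  qed
qed

lemma A_set_iff:
  "\<eta> \<in> A_set \<longleftrightarrow> finite {x. x \<le> 0 \<and> \<eta> x} \<and> finite {x. 1 \<le> x \<and> \<not> \<eta> x} \<and>
     card {x. x \<le> 0 \<and> \<eta> x} = card {x. 1 \<le> x \<and> \<not> \<eta> x}"
proof -
  have [simp]: "(1 - of_bool b :: ennreal) = of_bool (\<not> b)" for b by simp
  have top: "of_nat n = (\<infinity>::ennreal) \<longleftrightarrow> False" "(\<infinity>::ennreal) = of_nat n \<longleftrightarrow> False" for n
    by (auto simp: ennreal_of_nat_eq_real_of_nat)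
  show ?thesis
    by (auto simp: A_set_def infsum_of_bool_ennreal top less_top[symmetric])
qed

lemma height_unique:
  assumes "\<eta> \<in> A_set"
  shows "\<exists>!h :: int \<Rightarrow> int. (h \<longlongrightarrow> 0) at_bot \<and> (\<forall>x. h (x + 1) - h x = of_bool (\<eta> x))"
proof (rule ex1I, intro conjI allI)
  define h :: "int \<Rightarrow> int" where "h x = int (card {y. y < x \<and> \<eta> y})" for x
  have fin0: "finite {x. x \<le> 0 \<and> \<eta> x}" using assms by (simp add: A_set_iff)
  have fin: "finite {y. y < x \<and> \<eta> y}" for x
    by (rule finite_subset[of _ "{x. x \<le> 0 \<and> \<eta> x} \<union> {0..x}"]) (use fin0 in auto)
  show step: "h (x + 1) - h x = of_bool (\<eta> x)" for x
  proof -
    have "{y. y < x + 1 \<and> \<eta> y} = (if \<eta> x then insert x {y. y < x \<and> \<eta> y} else {y. y < x \<and> \<eta> y})"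
      by (auto simp: order.order_iff_strict)
    then show ?thesis using fin[of x] by (simp add: h_def)
  qed
  show lim: "(h \<longlongrightarrow> 0) at_bot"
  proof -
    obtain N where N: "\<And>y. y \<le> 0 \<Longrightarrow> \<eta> y \<Longrightarrow> N \<le> y"
      using bdd_below_finite[OF fin0] unfolding bdd_below_def by blast
    have "h x = 0" if "x \<le> min N 0" for x
    proof -
      have "{y. y < x \<and> \<eta> y} = {}" by (smt (verit) N Collect_empty_eq min.boundedE that)
      then show ?thesis by (simp only: h_def card.empty of_nat_0)
    qed
    then show ?thesis
      by (intro tendsto_eventually) (unfold eventually_at_bot_linorder, blast)
  qed
  fix g :: "int \<Rightarrow> int"
  assume g: "(g \<longlongrightarrow> 0) at_bot \<and> (\<forall>x. g (x + 1) - g x = of_bool (\<eta> x))"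
  define d where "d x = g x - h x" for x
  have d: "d (x + 1) = d x" for x using g step[of x] by (smt (verit) d_def)
  have dc: "d x = d 0" for x
  proof (induction x rule: int_induct[where k = 0])
    case (step1 i) then show ?case using d[of i] by simp
  next
    case (step2 i) then show ?case using d[of "i - 1"] by simp
  qed simp
  have "eventually (\<lambda>x. g x = 0) at_bot" "eventually (\<lambda>x. h x = 0) at_bot"
    using g lim by (simp_all add: tendsto_discrete)
  then have "eventually (\<lambda>x. d x = 0) at_bot"
    by eventually_elim (simp add: d_def)
  then obtain N where "d N = 0"
    by (auto simp: eventually_at_bot_linorder)
  then have "d x = 0" for x using dc[of N] dc[of x] by simp
  then show "g = h" by (simp add: fun_eq_iff d_def)
qed

end

theory Submission
  imports Defs
begin

text \<open>
  For \<open>b\<^sub>1 + b\<^sub>2 > 1\<close> the operators \<open>P\<^sub>k\<close> are not attractive, so the usual monotone coupling is not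
  available. Instead write \<open>P\<^sub>k = (1 - b\<^sub>2) I + b\<^sub>2 T\<^sub>k\<close>, where \<open>T\<^sub>k\<close> has the rates \<open>q = b\<^sub>1 / b\<^sub>2\<close>
  and \<open>1\<close>. The \<open>T\<^sub>k\<close> satisfy the braid relations and \<open>T\<^sub>k\<^sup>2 = q I + (1 - q) T\<^sub>k\<close>, whose
  coefficients are nonnegative, so a product of \<open>P\<^sub>k\<close>'s applied to the ground state is a convex
  combination of products of \<open>T\<^sub>k\<close>'s along words that grow a Young diagram box by box.

  Such a product is dominated by \<open>\<pi>\<close> by induction over the rows of the diagram. Let \<open>\<pi>\<^sub>j\<close> be the
  blocking measure of \<open>j\<close> particles with all sites beyond \<open>j\<close> filled; \<open>\<pi>\<^sub>0\<close> is the ground state,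
  and \<open>\<pi>\<^sub>j\<close> is the image of \<open>\<pi>\<close> under a map that lowers the height. Adding a first row to \<open>\<pi>\<^sub>j\<close>
  yields \<open>T\<^sub>m \<dots> T\<^sub>j \<pi>\<^sub>j\<close>, which has an explicit density with respect to \<open>\<pi>\<^bsub>j+1\<^esub>\<close> (a duality
  function of the exclusion process). It can be coupled monotonically with \<open>\<pi>\<^bsub>j+1\<^esub>\<close> so that both
  configurations agree to the right of \<open>m\<close>, which is all that the later rows act on; hence the
  first row may be replaced by an infinite one.
\<close>

section \<open>Height functions\<close>

lemma height_props:
  assumes "\<eta> \<in> A_set"
  shows height_Suc: "height \<eta> (x + 1) = height \<eta> x + of_bool (\<eta> x)"
    and height_eventually_0: "\<exists>N. \<forall>x\<le>N. height \<eta> x = 0"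
proof -
  have *: "(height \<eta> \<longlongrightarrow> 0) at_bot \<and> (\<forall>x. height \<eta> (x + 1) - height \<eta> x = of_bool (\<eta> x))"
    unfolding height_def by (rule theI'[OF height_unique[OF assms]])
  then show "height \<eta> (x + 1) = height \<eta> x + of_bool (\<eta> x)"
    by (metis add.commute diff_add_cancel)
  show "\<exists>N. \<forall>x\<le>N. height \<eta> x = 0"
    using * by (simp add: tendsto_discrete eventually_at_bot_linorder)
qed

lemma increments_sum:
  fixes h :: "int \<Rightarrow> int"
  assumes "\<And>x. h (x + 1) = h x + of_bool (\<eta> x)" "a \<le> b"
  shows "h b - h a = int (card {x. a \<le> x \<and> x < b \<and> \<eta> x})"
  using assms(2)
proof (induction b rule: int_ge_induct)
  case (step i)
  have "{x. a \<le> x \<and> x < i + 1 \<and> \<eta> x} =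
      (if \<eta> i then insert i {x. a \<le> x \<and> x < i \<and> \<eta> x} else {x. a \<le> x \<and> x < i \<and> \<eta> x})"
    using step.hyps by (auto simp: order.order_iff_strict)
  moreover have "finite {x. a \<le> x \<and> x < i \<and> \<eta> x}"
    by (rule finite_subset[of _ "{a..i}"]) auto
  ultimately show ?case using step.IH assms(1)[of i] by simp
next
  case base
  have "{x. a \<le> x \<and> x < a \<and> \<eta> x} = {}" by auto
  then show ?case by (simp only: card.empty)
qed

lemma height_mono:
  assumes "\<eta> \<in> A_set" "x \<le> y"
  shows "height \<eta> x \<le> height \<eta> y"
  using increments_sum[where h = "height \<eta>", OF height_Suc[OF assms(1)] assms(2)] by linarith

text \<open>Beyond the last hole, the particles below x are those at sites up to 0 together with the
  x - 1 sites of \<open>{1..<x}\<close> minus the holes there. The first and the last number cancel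
  by the balance condition in \<open>A_set\<close>.\<close>

lemma height_eventually_ground:
  assumes "\<eta> \<in> A_set"
  shows "\<exists>N. \<forall>x\<ge>N. height \<eta> x = x - 1"
proof -
  note A = assms[unfolded A_set_iff]
  obtain N where N: "N \<ge> 1" "\<And>x. x \<ge> N \<Longrightarrow> \<eta> x"
  proof -
    obtain M where "\<And>x. 1 \<le> x \<Longrightarrow> \<not> \<eta> x \<Longrightarrow> x \<le> M"
      using bdd_above_finite[of "{x. 1 \<le> x \<and> \<not> \<eta> x}"] A unfolding bdd_above_def by blast
    then show ?thesis by (intro that[of "max 1 (M + 1)"]) force+
  qed
  obtain K where K: "\<And>x. x \<le> K \<Longrightarrow> height \<eta> x = 0"
    using height_eventually_0[OF assms] by blast
  define a where "a = min K 0"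
  have nopart: "\<not> \<eta> x" if "x < K" for x
    using height_Suc[OF assms, of x] K[of x] K[of "x + 1"] that by (auto split: if_splits)
  have h1: "height \<eta> 1 = int (card {x. x \<le> 0 \<and> \<eta> x})"
  proof -
    have "{x. a \<le> x \<and> x < 1 \<and> \<eta> x} = {x. x \<le> 0 \<and> \<eta> x}"
      using nopart by (force simp: a_def)
    with increments_sum[where h = "height \<eta>", OF height_Suc[OF assms], where a = a and b = 1] K[of a]
    show ?thesis by (simp add: a_def)
  qed
  have "height \<eta> x = x - 1" if "x \<ge> N" for x
  proof -
    have "height \<eta> x - height \<eta> 1 = int (card {y. 1 \<le> y \<and> y < x \<and> \<eta> y})"
      using increments_sum[where h = "height \<eta>", OF height_Suc[OF assms], where a = 1 and b = x] that N
      by simp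
    moreover have "card ({y. 1 \<le> y \<and> y < x \<and> \<eta> y} \<union> {y. 1 \<le> y \<and> \<not> \<eta> y}) =
        card {y. 1 \<le> y \<and> y < x \<and> \<eta> y} + card {y. 1 \<le> y \<and> \<not> \<eta> y}"
      using A by (intro card_Un_disjoint) (auto intro: finite_subset[of _ "{1..x}"])
    moreover have "{y. 1 \<le> y \<and> y < x \<and> \<eta> y} \<union> {y. 1 \<le> y \<and> \<not> \<eta> y} = {1..<x}"
      using N that by (auto; metis linorder_not_le order_trans)
    ultimately show ?thesis using h1 A that N by (simp add: nat_diff_distrib)
  qed
  then show ?thesis by blast
qed

text \<open>Heights of modified configurations are found by guessing a function with the right
  increments and both tails. Membership in \<open>A_set\<close> and the height then come together,
  without counting sites again.\<close>

lemma A_heightI: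
  assumes low: "\<forall>x\<le>N. h x = 0"
    and step: "\<And>x. h (x + 1) = h x + of_bool (\<eta> x)"
    and up: "\<forall>x\<ge>M. h x = x - 1"
  shows A_setI_height: "\<eta> \<in> A_set" and height_eqI: "height \<eta> = h"
proof -
  define a where "a = min N 0"
  define b where "b = max M 1"
  have lo: "\<not> \<eta> x" if "x < N" for x
    using step[of x] low that by (auto split: if_splits)
  have hi: "\<eta> x" if "x \<ge> M" for x
    using step[of x] up that by (auto split: if_splits)
  have f1: "finite {x. x \<le> 0 \<and> \<eta> x}"
    by (rule finite_subset[of _ "{N..0}"]) (use lo in force)+
  have f2: "finite {x. 1 \<le> x \<and> \<not> \<eta> x}"
    by (rule finite_subset[of _ "{1..M}"])
      (use hi in \<open>auto simp: not_le[symmetric]\<close>, metis linorder_linear)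
  have "{x. a \<le> x \<and> x < 1 \<and> \<eta> x} = {x. x \<le> 0 \<and> \<eta> x}"
    using lo by (force simp: a_def)
  with increments_sum[where h = h, OF step, where a = a and b = 1] low
  have 1: "h 1 = int (card {x. x \<le> 0 \<and> \<eta> x})" by (simp add: a_def)
  have 2: "h b - h 1 = int (card {y. 1 \<le> y \<and> y < b \<and> \<eta> y})"
    by (rule increments_sum[where h = h, OF step]) (simp add: b_def)
  have 3: "h b = b - 1" using up by (simp add: b_def)
  have "card ({y. 1 \<le> y \<and> y < b \<and> \<eta> y} \<union> {y. 1 \<le> y \<and> \<not> \<eta> y}) =
        card {y. 1 \<le> y \<and> y < b \<and> \<eta> y} + card {y. 1 \<le> y \<and> \<not> \<eta> y}"
    using f2 by (intro card_Un_disjoint) (auto intro: finite_subset[of _ "{1..b}"])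
  moreover have "{y. 1 \<le> y \<and> y < b \<and> \<eta> y} \<union> {y. 1 \<le> y \<and> \<not> \<eta> y} = {1..<b}"
    using hi by (auto simp: b_def less_max_iff_disj) (metis linorder_not_le)
  ultimately show "\<eta> \<in> A_set"
    using 1 2 3 f1 f2 by (simp add: A_set_iff b_def nat_diff_distrib)
  have "(h \<longlongrightarrow> 0) at_bot"
    using low by (intro tendsto_eventually) (unfold eventually_at_bot_linorder, blast)
  with step height_unique[OF \<open>\<eta> \<in> A_set\<close>] show "height \<eta> = h"
    unfolding height_def by (intro the1_equality) (auto simp: algebra_simps)
qed

lemma ground_A: "(\<lambda>x. x > 0) \<in> A_set"
proof -
  have "{x::int. x \<le> 0 \<and> 0 < x} = {}" "{x::int. 1 \<le> x \<and> \<not> 0 < x} = {}" by auto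
  then show ?thesis by (simp only: A_set_iff) simp
qed

lemma height_nonneg: "\<eta> \<in> A_set \<Longrightarrow> 0 \<le> height \<eta> x"
  by (metis height_eventually_0 height_mono linear min.cobounded1 min.cobounded2)

lemma height_Suc_le: "\<eta> \<in> A_set \<Longrightarrow> height \<eta> (x + 1) \<le> height \<eta> x + 1"
  by (simp add: height_Suc)

lemma height_lipschitz:
  assumes "\<eta> \<in> A_set" "x \<le> y"
  shows "height \<eta> y \<le> height \<eta> x + (y - x)"
  using assms(2)
proof (induction y rule: int_ge_induct)
  case (step i) then show ?case using height_Suc_le[OF assms(1), of i] by linarith
qed simp

text \<open>Heights grow by at most 1 per site and equal x - 1 far to the right, so going back to x
  loses at most the distance travelled.\<close>

lemma height_ge_ground:
  assumes "\<eta> \<in> A_set"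
  shows "x - 1 \<le> height \<eta> x"
proof -
  obtain N where "\<And>y. y \<ge> N \<Longrightarrow> height \<eta> y = y - 1"
    using height_eventually_ground[OF assms] by blast
  with height_lipschitz[OF assms, of x "max N x"] show ?thesis by simp
qed

section \<open>Swaps and shifts of configurations in A\<close>

lemma swap_config_apply:
  "swap_config k \<eta> x = (if x = k then \<eta> (k + 1) else if x = k + 1 then \<eta> k else \<eta> x)"
  by (simp add: swap_config_def)

lemma swap_config_swap_config [simp]: "swap_config k (swap_config k \<eta>) = \<eta>"
  by (auto simp: swap_config_apply fun_eq_iff)

lemma swap_config_same: "\<eta> k = \<eta> (k + 1) \<Longrightarrow> swap_config k \<eta> = \<eta>"
  by (auto simp: swap_config_apply fun_eq_iff)

lemma swap_config_A:
  assumes "\<eta> \<in> A_set"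
  shows swap_config_in_A: "swap_config k \<eta> \<in> A_set"
    and height_swap_config: "height (swap_config k \<eta>) =
      (\<lambda>x. if x = k + 1 then height \<eta> k + of_bool (\<eta> (k + 1)) else height \<eta> x)"
proof -
  let ?h = "\<lambda>x. if x = k + 1 then height \<eta> k + of_bool (\<eta> (k + 1)) else height \<eta> x"
  obtain N where N: "\<forall>x\<le>N. height \<eta> x = 0" using height_eventually_0[OF assms] by blast
  obtain M where M: "\<forall>x\<ge>M. height \<eta> x = x - 1"
    using height_eventually_ground[OF assms] by blast
  have 1: "\<forall>x\<le>min N k. ?h x = 0" using N by auto
  have 3: "\<forall>x\<ge>max M (k + 2). ?h x = x - 1" using M by auto
  have 2: "?h (x + 1) = ?h x + of_bool (swap_config k \<eta> x)" for x
    using height_Suc[OF assms, of k] height_Suc[OF assms, of "k + 1"] height_Suc[OF assms, of x]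
    by (auto simp: swap_config_apply add.assoc)
  show "swap_config k \<eta> \<in> A_set" "height (swap_config k \<eta>) = ?h"
    using A_heightI[where h = ?h, OF 1 2 3] by blast+
qed

lemma swap_config_A_iff [simp]: "swap_config k \<eta> \<in> A_set \<longleftrightarrow> \<eta> \<in> A_set"
  by (metis swap_config_in_A swap_config_swap_config)

text \<open>The sites up to m are shifted to the left by one and a hole is put at m. For \<eta> in
  \<open>A_set\<close> this adds a column of length \<open>height \<eta> (m + 1)\<close> to the
  Young diagram.\<close>

definition bubble :: "int \<Rightarrow> config \<Rightarrow> config" where
  "bubble m \<eta> = (\<lambda>x. if x < m then \<eta> (x + 1) else x \<noteq> m \<and> \<eta> x)"

definition unbubble :: "int \<Rightarrow> config \<Rightarrow> config" where
  "unbubble m \<eta> = (\<lambda>x. if x \<le> m then \<eta> (x - 1) else \<eta> x)"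

lemma unbubble_bubble [simp]: "unbubble m (bubble m \<eta>) = \<eta>"
  by (auto simp: bubble_def unbubble_def fun_eq_iff)

lemma bubble_unbubble: "\<not> \<eta> m \<Longrightarrow> bubble m (unbubble m \<eta>) = \<eta>"
  by (auto simp: bubble_def unbubble_def fun_eq_iff)

lemma bubble_A:
  assumes "\<eta> \<in> A_set"
  shows bubble_in_A: "bubble m \<eta> \<in> A_set"
    and height_bubble: "height (bubble m \<eta>) =
      (\<lambda>x. if x \<le> m then height \<eta> (x + 1) else height \<eta> x)"
proof -
  let ?h = "\<lambda>x. if x \<le> m then height \<eta> (x + 1) else height \<eta> x"
  obtain N where N: "\<forall>x\<le>N. height \<eta> x = 0" using height_eventually_0[OF assms] by blast
  obtain M where M: "\<forall>x\<ge>M. height \<eta> x = x - 1"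
    using height_eventually_ground[OF assms] by blast
  have 1: "\<forall>x\<le>min (N - 1) m. ?h x = 0" using N by auto
  have 3: "\<forall>x\<ge>max M (m + 1). ?h x = x - 1" using M by auto
  have 2: "?h (x + 1) = ?h x + of_bool (bubble m \<eta> x)" for x
    using height_Suc[OF assms, of "x + 1"] height_Suc[OF assms, of x]
    by (auto simp: bubble_def)
  show "bubble m \<eta> \<in> A_set" "height (bubble m \<eta>) = ?h"
    using A_heightI[where h = ?h, OF 1 2 3] by blast+
qed

lemma unbubble_A:
  assumes "\<eta> \<in> A_set" "\<not> \<eta> m"
  shows "unbubble m \<eta> \<in> A_set"
proof -
  let ?h = "\<lambda>x. if x \<le> m + 1 then height \<eta> (x - 1) else height \<eta> x"
  obtain N where N: "\<forall>x\<le>N. height \<eta> x = 0" using height_eventually_0[OF assms(1)] by blast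
  obtain M where M: "\<forall>x\<ge>M. height \<eta> x = x - 1"
    using height_eventually_ground[OF assms(1)] by blast
  have 1: "\<forall>x\<le>min N m. ?h x = 0" using N by auto
  have 3: "\<forall>x\<ge>max M (m + 2). ?h x = x - 1" using M by auto
  \<comment> \<open>The two branches of \<open>?h\<close> meet at \<open>x = m + 1\<close>, where
    the hole at m gives \<open>height \<eta> (m + 1) = height \<eta> m\<close>.\<close>
  have 2: "?h (x + 1) = ?h x + of_bool (unbubble m \<eta> x)" for x
    using height_Suc[OF assms(1), of "x - 1"] height_Suc[OF assms(1), of x]
      height_Suc[OF assms(1), of m] assms(2)
    by (cases "x = m + 1") (auto simp: unbubble_def)
  show ?thesis
    using A_heightI[where h = ?h, OF 1 2 3] by blast
qed

section \<open>The operators as a Hecke algebra action\<close>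

definition step_pmf :: "real \<Rightarrow> real \<Rightarrow> int \<Rightarrow> config \<Rightarrow> config pmf" where
  "step_pmf b1 b2 k \<eta> =
     map_pmf (\<lambda>s. if s then swap_config k \<eta> else \<eta>) (bernoulli_pmf (swap_rate b1 b2 k \<eta>))"

definition op_pmf :: "real \<Rightarrow> real \<Rightarrow> int \<Rightarrow> config pmf \<Rightarrow> config pmf" where
  "op_pmf b1 b2 k p = bind_pmf p (step_pmf b1 b2 k)"

text \<open>The action on mass functions: \<eta> is reached only from itself and from its swap. If
  sites k and k + 1 agree, the two coincide, but then the rate is 0 and nothing is counted
  twice.\<close>

definition mass_op :: "real \<Rightarrow> real \<Rightarrow> int \<Rightarrow> (config \<Rightarrow> real) \<Rightarrow> config \<Rightarrow> real" where
  "mass_op b1 b2 k f \<eta> = (1 - swap_rate b1 b2 k \<eta>) * f \<eta> +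
     swap_rate b1 b2 k (swap_config k \<eta>) * f (swap_config k \<eta>)"

lemma swap_rate_bounds:
  assumes "0 \<le> b1" "b1 \<le> 1" "0 \<le> b2" "b2 \<le> 1"
  shows "0 \<le> swap_rate b1 b2 k \<eta>" "swap_rate b1 b2 k \<eta> \<le> 1"
  using assms by (auto simp: swap_rate_def)

lemma pmf_step_pmf:
  assumes "0 \<le> b1" "b1 \<le> 1" "0 \<le> b2" "b2 \<le> 1"
  shows "pmf (step_pmf b1 b2 k \<xi>) \<eta> = (1 - swap_rate b1 b2 k \<xi>) * of_bool (\<xi> = \<eta>) +
    swap_rate b1 b2 k \<xi> * of_bool (swap_config k \<xi> = \<eta>)"
proof -
  let ?r = "swap_rate b1 b2 k \<xi>"
  have "pmf (step_pmf b1 b2 k \<xi>) \<eta> =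
      (\<integral>s. pmf (return_pmf (if s then swap_config k \<xi> else \<xi>)) \<eta> \<partial>bernoulli_pmf ?r)"
    by (simp add: step_pmf_def map_pmf_def pmf_bind)
  also have "\<dots> = ?r * of_bool (swap_config k \<xi> = \<eta>) + (1 - ?r) * of_bool (\<xi> = \<eta>)"
    using swap_rate_bounds[OF assms, of k \<xi>]
    by (subst integral_bernoulli_pmf) (auto simp: indicator_def)
  finally show ?thesis by simp
qed

lemma pmf_op_pmf:
  assumes b: "0 \<le> b1" "b1 \<le> 1" "0 \<le> b2" "b2 \<le> 1"
  shows "pmf (op_pmf b1 b2 k p) = mass_op b1 b2 k (pmf p)"
proof
  fix \<eta>
  have sw: "swap_config k \<xi> = \<eta> \<longleftrightarrow> \<xi> = swap_config k \<eta>" for \<xi>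
    by (metis swap_config_swap_config)
  have "pmf (op_pmf b1 b2 k p) \<eta> =
      (\<Sum>\<xi>\<in>{\<eta>, swap_config k \<eta>}. pmf (step_pmf b1 b2 k \<xi>) \<eta> * pmf p \<xi>)"
    unfolding op_pmf_def pmf_bind
    by (rule integral_measure_pmf_real) (auto simp: pmf_step_pmf[OF b] sw split: if_splits)
  also have "\<dots> = mass_op b1 b2 k (pmf p) \<eta>"
    by (cases "\<eta> = swap_config k \<eta>")
      (auto simp: pmf_step_pmf[OF b] sw mass_op_def algebra_simps)
  finally show "pmf (op_pmf b1 b2 k p) \<eta> = mass_op b1 b2 k (pmf p) \<eta>" .
qed

definition mix_pmf :: "real \<Rightarrow> 'a pmf \<Rightarrow> 'a pmf \<Rightarrow> 'a pmf" where
  "mix_pmf c p p' = bind_pmf (bernoulli_pmf c) (\<lambda>b. if b then p else p')"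

lemma pmf_mix_pmf:
  assumes "0 \<le> c" "c \<le> 1"
  shows "pmf (mix_pmf c p p') x = c * pmf p x + (1 - c) * pmf p' x"
  using assms by (simp add: mix_pmf_def pmf_bind)

lemma op_pmf_mix_pmf:
  "op_pmf b1 b2 k (mix_pmf c p p') = mix_pmf c (op_pmf b1 b2 k p) (op_pmf b1 b2 k p')"
  unfolding op_pmf_def mix_pmf_def bind_assoc_pmf by (intro bind_pmf_cong) auto

locale asym =
  fixes q :: real
  assumes q: "0 < q" "q < 1"
begin

abbreviation T :: "int \<Rightarrow> config pmf \<Rightarrow> config pmf" where
  "T \<equiv> op_pmf q 1"

abbreviation Tm :: "int \<Rightarrow> (config \<Rightarrow> real) \<Rightarrow> config \<Rightarrow> real" where
  "Tm \<equiv> mass_op q 1"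

lemma pmf_T: "pmf (T k p) = Tm k (pmf p)"
  using q by (intro pmf_op_pmf) auto

lemma T_eqI: "Tm k (pmf p) = pmf p' \<Longrightarrow> T k p = p'"
  by (rule pmf_eqI) (simp add: pmf_T)

text \<open>Only the sites k, k + 1 and k + 2 take part. With all others frozen, the relation is
  checked on the eight local states \<open>C a b c\<close>.\<close>

lemma Tm_braid: "Tm k (Tm (k + 1) (Tm k f)) = Tm (k + 1) (Tm k (Tm (k + 1) f))"
proof
  fix \<zeta>
  define F where "F a b c = f (\<zeta>(k := a, k + 1 := b, k + 2 := c))" for a b c
  define C where "C a b c = \<zeta>(k := a, k + 1 := b, k + 2 := c)" for a b c
  define \<rho> where "\<rho> a b = (if \<not> a \<and> b then q else if a \<and> \<not> b then 1 else 0)" for a b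
  have 1: "Tm k g (C a b c) = (1 - \<rho> a b) * g (C a b c) + \<rho> b a * g (C b a c)" for g a b c
  proof -
    have "swap_config k (C a b c) = C b a c"
      by (auto simp: C_def swap_config_apply fun_eq_iff)
    then show ?thesis by (simp add: mass_op_def swap_rate_def \<rho>_def C_def)
  qed
  have 2: "Tm (k + 1) g (C a b c) = (1 - \<rho> b c) * g (C a b c) + \<rho> c b * g (C a c b)" for g a b c
  proof -
    have "swap_config (k + 1) (C a b c) = C a c b"
      by (auto simp: C_def swap_config_apply fun_eq_iff add.assoc)
    then show ?thesis by (simp add: mass_op_def swap_rate_def \<rho>_def C_def add.assoc)
  qed
  have "Tm k (Tm (k + 1) (Tm k f)) (C a b c) = Tm (k + 1) (Tm k (Tm (k + 1) f)) (C a b c)" for a b c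
    unfolding 1 2 by (cases a; cases b; cases c) (simp_all add: \<rho>_def algebra_simps)
  moreover have "\<zeta> = C (\<zeta> k) (\<zeta> (k + 1)) (\<zeta> (k + 2))" by (simp add: C_def)
  ultimately show "Tm k (Tm (k + 1) (Tm k f)) \<zeta> = Tm (k + 1) (Tm k (Tm (k + 1) f)) \<zeta>" by metis
qed

lemma T_braid: "T k (T (k + 1) (T k p)) = T (k + 1) (T k (T (k + 1) p))"
  by (rule pmf_eqI) (simp only: pmf_T Tm_braid)

lemma Tm_commute:
  assumes "\<bar>k - l\<bar> \<ge> 2"
  shows "Tm k (Tm l f) = Tm l (Tm k f)"
proof
  fix \<eta>
  have s: "swap_config k (swap_config l \<eta>) = swap_config l (swap_config k \<eta>)"
    using assms by (auto simp: swap_config_apply fun_eq_iff)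
  have r: "swap_rate q 1 k (swap_config l \<zeta>) = swap_rate q 1 k \<zeta>"
     "swap_rate q 1 l (swap_config k \<zeta>) = swap_rate q 1 l \<zeta>" for \<zeta>
    using assms by (auto simp: swap_rate_def swap_config_apply)
  show "Tm k (Tm l f) \<eta> = Tm l (Tm k f) \<eta>"
    unfolding mass_op_def s r by (simp add: r s[symmetric] algebra_simps)
qed

lemma T_commute: "\<bar>k - l\<bar> \<ge> 2 \<Longrightarrow> T k (T l p) = T l (T k p)"
  by (rule pmf_eqI) (simp only: pmf_T Tm_commute)

text \<open>On a pair of unequal sites \<open>T k\<close> is a 2 x 2 matrix of trace 1 - q and
  determinant -q, so this is its Cayley-Hamilton identity. On equal sites \<open>T k\<close> is the
  identity.\<close>

lemma T_quadratic: "T k (T k p) = mix_pmf q p (T k p)"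
proof (rule pmf_eqI)
  fix \<eta>
  show "pmf (T k (T k p)) \<eta> = pmf (mix_pmf q p (T k p)) \<eta>"
    using q unfolding pmf_T pmf_mix_pmf[OF less_imp_le less_imp_le, OF q]
    by (auto simp: mass_op_def swap_rate_def swap_config_apply swap_config_same algebra_simps)
qed

text \<open>With probability \<open>b2\<close> a swap is attempted, and it is accepted with the
  rates q and 1 of \<open>T k\<close>.\<close>

lemma op_pmf_eq_mix_T:
  assumes "0 < b2" "b2 \<le> 1"
  shows "op_pmf (q * b2) b2 k p = mix_pmf b2 (T k p) p"
proof (rule pmf_eqI)
  fix \<eta>
  have *: "0 \<le> q * b2" "q * b2 \<le> 1" "0 \<le> b2"
    using assms q by (auto intro: mult_le_one)
  show "pmf (op_pmf (q * b2) b2 k p) \<eta> = pmf (mix_pmf b2 (T k p) p) \<eta>"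
    unfolding pmf_op_pmf[OF *(1,2,3) assms(2)] pmf_mix_pmf[OF *(3) assms(2)] pmf_T
    by (auto simp: mass_op_def swap_rate_def swap_config_apply algebra_simps)
qed

text \<open>Detailed balance for \<open>T k\<close>: the flow \<open>q * f \<eta>\<close> through
  the swap equals the return flow, whose rate is 1.\<close>

definition balanced :: "int \<Rightarrow> (config \<Rightarrow> real) \<Rightarrow> bool" where
  "balanced k f \<longleftrightarrow> (\<forall>\<eta>. \<not> \<eta> k \<longrightarrow> \<eta> (k + 1) \<longrightarrow> f (swap_config k \<eta>) = q * f \<eta>)"

text \<open>Detailed balance makes \<open>T k\<close> self-adjoint with respect to f. Hence it acts
  on a density g relative to f as the one-step expectation of g.\<close>

lemma Tm_balanced_mult:
  assumes "balanced k f"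
  shows "Tm k (\<lambda>\<eta>. f \<eta> * g \<eta>) \<eta> = f \<eta> *
    ((1 - swap_rate q 1 k \<eta>) * g \<eta> + swap_rate q 1 k \<eta> * g (swap_config k \<eta>))"
proof -
  have "swap_rate q 1 k (swap_config k \<eta>) * f (swap_config k \<eta>) = swap_rate q 1 k \<eta> * f \<eta>"
    using assms[unfolded balanced_def, rule_format, of \<eta>]
      assms[unfolded balanced_def, rule_format, of "swap_config k \<eta>"] q
    by (auto simp: swap_rate_def swap_config_apply)
  then show ?thesis by (simp add: mass_op_def algebra_simps)
qed

lemma T_balanced:
  assumes "balanced k (pmf p)"
  shows "T k p = p"
  by (rule T_eqI) (use Tm_balanced_mult[OF assms, of "\<lambda>_. 1"] in \<open>auto simp: fun_eq_iff\<close>)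

end

section \<open>Words growing Young diagrams\<close>

text \<open>A swap of an empty site \<open>k\<close> with a particle at \<open>k + 1\<close> adds a box to the Young diagram of the
  configuration. For \<open>j > 0\<close> the first \<open>j\<close> rows of the diagram are regarded as infinite and are
  left out. Words act from right to left.\<close>

inductive growth :: "nat \<Rightarrow> int list \<Rightarrow> config \<Rightarrow> bool" for j where
  growth_Nil: "growth j [] (\<lambda>x. x > int j)"
| growth_Cons: "growth j w \<sigma> \<Longrightarrow> \<not> \<sigma> k \<Longrightarrow> \<sigma> (k + 1) \<Longrightarrow> growth j (k # w) (swap_config k \<sigma>)"

context asym
begin

text \<open>The analogue of the exchange property of Coxeter groups: a removable box of the diagram
  may be taken to be the one added last. Either it already is, or the last letter commutes with k
  and the claim passes to the shorter word.\<close>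

lemma growth_exchange:
  assumes "growth j w \<sigma>" "\<sigma> k" "\<not> \<sigma> (k + 1)"
  shows "\<exists>w'. growth j w' (swap_config k \<sigma>) \<and> length w = Suc (length w') \<and>
    (\<forall>p. foldr T w p = T k (foldr T w' p))"
  using assms
proof (induction rule: growth.induct)
  case growth_Nil
  then show ?case by simp
next
  case (growth_Cons w \<sigma> l)
  show ?case
  proof (cases "l = k")
    case True
    with growth_Cons.hyps show ?thesis by (intro exI[of _ w]) simp
  next
    case False
    \<comment> \<open>The last swap leaves l occupied and l + 1 empty. A removable box at a
      neighbouring k would need the opposite value at the shared site.\<close>
    have far: "\<bar>k - l\<bar> \<ge> 2"
      using growth_Cons.prems growth_Cons.hyps False by (auto simp: swap_config_apply split: if_splits)
    then have "\<sigma> k" "\<not> \<sigma> (k + 1)"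
      using growth_Cons.prems by (auto simp: swap_config_apply split: if_splits)
    from growth_Cons.IH[OF this] obtain w' where
      w': "growth j w' (swap_config k \<sigma>)" "length w = Suc (length w')"
        "\<And>p. foldr T w p = T k (foldr T w' p)" by blast
    have "growth j (l # w') (swap_config l (swap_config k \<sigma>))"
      by (rule growth.growth_Cons[OF w'(1)])
        (use far growth_Cons.hyps in \<open>auto simp: swap_config_apply\<close>)
    moreover have "swap_config l (swap_config k \<sigma>) = swap_config k (swap_config l \<sigma>)"
      using far by (auto simp: swap_config_apply fun_eq_iff)
    ultimately show ?thesis
      using w' T_commute[OF far] by (intro exI[of _ "l # w'"]) auto
  qed
qed

text \<open>Here no box can be added or removed at k. If the last letter l is far from k,
  \<open>T k\<close> commutes past it. If l is a neighbour of k, the exchange property makes k the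
  letter before l, and T_k T_l T_k = T_l T_k T_l moves the question to \<open>T l\<close> on a
  shorter word, which fixes it by induction.\<close>

lemma T_foldr_growth_fixed:
  assumes "growth j w \<sigma>" "\<sigma> k = \<sigma> (k + 1)" and p: "\<And>l. l \<noteq> int j \<Longrightarrow> T l p = p"
  shows "T k (foldr T w p) = foldr T w p"
  using assms(1,2)
proof (induction "length w" arbitrary: w \<sigma> k rule: less_induct)
  case less
  from less.prems(1) show ?case
  proof cases
    case growth_Nil
    \<comment> \<open>In the initial configuration the sites k and k + 1 differ only for k = j, so
      \<open>p\<close> applies.\<close>
    with less.prems(2) show ?thesis by (auto intro: p)
  next
    case (growth_Cons w1 \<sigma>1 l)
    have braid: "T k (T l (foldr T w1 p)) = T l (foldr T w1 p)"
      if near: "l = k + 1 \<or> k = l + 1"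
    proof -
      have "\<sigma>1 k \<and> \<not> \<sigma>1 (k + 1)"
        using near less.prems(2) growth_Cons by (auto simp: swap_config_apply split: if_splits)
      then obtain w2 where w2: "growth j w2 (swap_config k \<sigma>1)" "length w1 = Suc (length w2)"
          "\<And>p. foldr T w1 p = T k (foldr T w2 p)"
        using growth_exchange[OF growth_Cons(3), of k] by blast
      have "T l (foldr T w2 p) = foldr T w2 p"
        by (rule less.hyps[OF _ w2(1)])
          (use near less.prems(2) growth_Cons w2(2) in
            \<open>auto simp: swap_config_apply add.assoc split: if_splits\<close>)
      with near show ?thesis
        using T_braid[of k "foldr T w2 p"] T_braid[of l "foldr T w2 p"] by (auto simp: w2(3))
    qed
    have "\<bar>k - l\<bar> \<ge> 2" if "\<not> (l = k + 1 \<or> k = l + 1)"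
      using that less.prems(2) growth_Cons by (cases "k = l") (auto simp: swap_config_apply)
    moreover have "T k (foldr T w1 p) = foldr T w1 p" if "\<bar>k - l\<bar> \<ge> 2"
      by (rule less.hyps[OF _ growth_Cons(3)])
        (use that less.prems(2) growth_Cons in \<open>auto simp: swap_config_apply split: if_splits\<close>)
    ultimately show ?thesis using braid T_commute[of k l] growth_Cons(1) by fastforce
  qed
qed

section \<open>Convex combinations of products along growing words\<close>

inductive growth_hull :: "nat \<Rightarrow> config pmf \<Rightarrow> config pmf \<Rightarrow> bool" for j p where
  growth_hull_growth: "growth j w \<sigma> \<Longrightarrow> growth_hull j p (foldr T w p)"
| growth_hull_mix: "growth_hull j p p1 \<Longrightarrow> growth_hull j p p2 \<Longrightarrow> 0 \<le> c \<Longrightarrow> c \<le> 1 \<Longrightarrow>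
    growth_hull j p (mix_pmf c p1 p2)"

text \<open>If neither adding nor removing a box at k is possible, \<open>T k\<close> fixes the
  product. An addable box lengthens the word. A removable box is made the last letter, and the
  quadratic relation gives a mixture of the product with that box and the product without
  it.\<close>

lemma growth_hull_T:
  assumes "growth_hull j p p'" and p: "\<And>l. l \<noteq> int j \<Longrightarrow> T l p = p"
  shows "growth_hull j p (T k p')"
  using assms(1)
proof (induction rule: growth_hull.induct)
  case (growth_hull_growth w \<sigma>)
  consider "\<sigma> k = \<sigma> (k + 1)" | "\<not> \<sigma> k" "\<sigma> (k + 1)" | "\<sigma> k" "\<not> \<sigma> (k + 1)" by blast
  then show ?case
  proof cases
    case 1
    with growth_hull_growth show ?thesis
      by (simp add: T_foldr_growth_fixed[OF _ _ p] growth_hull.growth_hull_growth)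
  next
    case 2
    from growth_hull.growth_hull_growth[OF growth_Cons[OF growth_hull_growth this]] show ?thesis by simp
  next
    case 3
    obtain w' where w': "growth j w' (swap_config k \<sigma>)" "foldr T w p = T k (foldr T w' p)"
      using growth_exchange[OF growth_hull_growth 3] by blast
    have "growth_hull j p (mix_pmf q (foldr T w' p) (foldr T w p))"
      using q
      by (intro growth_hull.growth_hull_mix growth_hull.growth_hull_growth[OF growth_hull_growth]
          growth_hull.growth_hull_growth[OF w'(1)]) auto
    then show ?thesis by (simp add: w'(2) T_quadratic)
  qed
next
  case (growth_hull_mix p1 p2 c)
  then show ?case by (simp add: op_pmf_mix_pmf growth_hull.growth_hull_mix)
qed

lemma growth_hull_op_pmf:
  assumes "growth_hull j p p'" "\<And>l. l \<noteq> int j \<Longrightarrow> T l p = p" "0 < b2" "b2 \<le> 1"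
  shows "growth_hull j p (op_pmf (q * b2) b2 k p')"
  unfolding op_pmf_eq_mix_T[OF assms(3,4)]
  using assms by (intro growth_hull_mix growth_hull_T) auto

lemma T_foldr_commute:
  assumes "\<And>l. l \<in> set w \<Longrightarrow> \<bar>k - l\<bar> \<ge> 2"
  shows "T k (foldr T w p) = foldr T w (T k p)"
  using assms by (induction w) (auto simp: T_commute)

text \<open>Splits off the first row of the Young diagram grown by \<open>w\<close>: it is added by the
  operators at \<open>j, j - 1, \<dots>, m\<close>, and all later rows only use sites to the right of \<open>m\<close>.\<close>

lemma growth_first_row:
  assumes "growth j w \<sigma>"
  shows "\<exists>m v \<sigma>'. m \<le> int j + 1 \<and> (w \<noteq> [] \<longrightarrow> m \<le> int j) \<and> (\<forall>k\<in>set v. m < k) \<and>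
    growth (Suc j) v \<sigma>' \<and> (\<forall>x\<le>m. \<not> \<sigma>' x) \<and> \<sigma> = (\<lambda>x. x = m \<or> \<sigma>' x) \<and>
    length w = length v + nat (int j + 1 - m) \<and>
    (\<forall>p. foldr T w p = foldr T v (foldr T [m..int j] p))"
  using assms
proof (induction rule: growth.induct)
  case growth_Nil
  have "growth (Suc j) [] (\<lambda>x. x > int (Suc j))" by (rule growth.growth_Nil)
  then show ?case
    by (intro exI[of _ "int j + 1"] exI[of _ "[]"] exI[of _ "\<lambda>x. x > int (Suc j)"]) (auto simp: fun_eq_iff)
next
  case (growth_Cons w \<sigma> k)
  then obtain m v \<sigma>' where *: "m \<le> int j + 1" "w \<noteq> [] \<longrightarrow> m \<le> int j" "\<forall>k\<in>set v. m < k"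
    "growth (Suc j) v \<sigma>'" "\<forall>x\<le>m. \<not> \<sigma>' x" "\<sigma> = (\<lambda>x. x = m \<or> \<sigma>' x)"
    "length w = length v + nat (int j + 1 - m)"
    "\<And>p. foldr T w p = foldr T v (foldr T [m..int j] p)"
    by blast
  show ?case
  proof (cases "k + 1 = m")
    case True
    then have "[k..int j] = k # [m..int j]" using *(1) by (auto simp: upto_rec1)
    \<comment> \<open>The letters of v exceed m = k + 1, so their distance from k is at least
      2.\<close>
    moreover have "T k (foldr T v p) = foldr T v (T k p)" for p
      by (rule T_foldr_commute) (use *(3) True in auto)
    moreover have "swap_config k \<sigma> = (\<lambda>x. x = k \<or> \<sigma>' x)"
      using True *(5,6) growth_Cons.hyps by (auto simp: swap_config_apply fun_eq_iff)
    ultimately show ?thesis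
      using * True by (intro exI[of _ k] exI[of _ v] exI[of _ \<sigma>']) auto
  next
    case False
    then have k: "\<sigma>' (k + 1)" "\<not> \<sigma>' k" "k \<noteq> m" using growth_Cons.hyps *(6) by auto
    then have "k > m" using *(5)
      by (metis add_le_imp_le_right linorder_not_le order.order_iff_strict zless_imp_add1_zle)
    moreover have "growth (Suc j) (k # v) (swap_config k \<sigma>')"
      using k by (intro growth.growth_Cons *(4))
    \<comment> \<open>No later row can grow before the first one: if that is empty, so is w, and the
      only addable box is at k = j, where k + 1 = m.\<close>
    moreover have "m \<le> int j"
    proof (rule ccontr)
      assume "\<not> m \<le> int j"
      with * have "w = []" "m = int j + 1" by auto
      with growth_Cons.hyps(1) have "\<sigma> = (\<lambda>x. x > int j)" by (auto elim: growth.cases)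
      with growth_Cons.hyps(2,3) \<open>m = int j + 1\<close> \<open>k + 1 \<noteq> m\<close> show False by auto
    qed
    moreover have "swap_config k \<sigma> = (\<lambda>x. x = m \<or> swap_config k \<sigma>' x)"
      using \<open>k > m\<close> *(6) by (auto simp: swap_config_apply fun_eq_iff)
    moreover have "\<forall>x\<le>m. \<not> swap_config k \<sigma>' x"
      using \<open>k > m\<close> *(5) by (auto simp: swap_config_apply)
    ultimately show ?thesis
      using * by (intro exI[of _ m] exI[of _ "k # v"] exI[of _ "swap_config k \<sigma>'"]) auto
  qed
qed

end

section \<open>Blocking measures of finitely many particles\<close>

lemma height_full:
  assumes "\<eta> \<in> A_set" "\<forall>x>n. \<eta> x" "n < x"
  shows "height \<eta> x = x - 1"
proof -
  have *: "height \<eta> y = height \<eta> x + (y - x)" if "x \<le> y" for y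
    using that
  proof (induction y rule: int_ge_induct)
    case (step i)
    with assms(2,3) show ?case by (simp add: height_Suc[OF assms(1)])
  qed simp
  obtain N where "\<And>y. y \<ge> N \<Longrightarrow> height \<eta> y = y - 1"
    using height_eventually_ground[OF assms(1)] by blast
  with *[of "max x N"] show ?thesis by simp
qed

lemma particle_unique:
  assumes "\<eta> \<in> A_set" "height \<eta> x = height \<eta> y" "\<eta> x" "\<eta> y"
  shows "x = y"
proof -
  have "False" if "x < y" "height \<eta> x = height \<eta> y" "\<eta> x" for x y
    using height_mono[OF assms(1), of "x + 1" y] height_Suc[OF assms(1), of x] that by simp
  with assms show ?thesis by (metis linorder_neqE)
qed

section \<open>Particle positions and truncation to finitely many rows\<close>

definition particle :: "nat \<Rightarrow> config \<Rightarrow> int" where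
  "particle n \<eta> = (THE x. height \<eta> x = int n \<and> \<eta> x)"

lemma particle_eqI:
  assumes "\<eta> \<in> A_set" "height \<eta> x = int n" "\<eta> x"
  shows "particle n \<eta> = x"
  unfolding particle_def using assms particle_unique[OF assms(1)]
  by (intro the_equality) (metis, metis)

lemma particle:
  assumes "\<eta> \<in> A_set"
  shows "height \<eta> (particle n \<eta>) = int n" "\<eta> (particle n \<eta>)"
proof -
  obtain a where a: "height \<eta> a = 0" using height_eventually_0[OF assms] by blast
  \<comment> \<open>The first place where the height exceeds n; the site just before it carries the
    particle with n particles to its left.\<close>
  define d where "d = (LEAST d. height \<eta> (a + int d) > int n)"
  have "height \<eta> (a + int (nat (int n + 2 + \<bar>a\<bar>))) > int n"
    using height_ge_ground[OF assms, of "a + int (nat (int n + 2 + \<bar>a\<bar>))"] by simp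
  then have d: "height \<eta> (a + int d) > int n" unfolding d_def by (rule LeastI)
  then have "d \<noteq> 0" using a by (intro notI) simp
  then obtain e where e: "d = Suc e" by (cases d) auto
  then have "\<not> height \<eta> (a + int e) > int n"
    unfolding d_def by (metis lessI not_less_Least)
  then have "height \<eta> (a + int e) = int n \<and> \<eta> (a + int e)"
    using d height_Suc[OF assms, of "a + int e"] by (cases "\<eta> (a + int e)") (auto simp: e algebra_simps)
  then show "height \<eta> (particle n \<eta>) = int n" "\<eta> (particle n \<eta>)"
    using particle_eqI[OF assms] by auto
qed

lemma particle_le: "\<eta> \<in> A_set \<Longrightarrow> particle n \<eta> \<le> int n + 1"
  using height_ge_ground[of \<eta> "particle n \<eta>"] particle(1)[of \<eta> n] by simp

text \<open>In terms of Young diagrams, \<open>keep_rows n\<close> deletes the columns of length exceeding \<open>n\<close>.\<close>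

definition keep_rows :: "nat \<Rightarrow> config \<Rightarrow> config" where
  "keep_rows n \<eta> = (\<lambda>x. int n < x \<or> \<eta> (x - (int n + 1) + particle n \<eta>))"

lemma keep_rows_A:
  assumes "\<eta> \<in> A_set"
  shows keep_rows_in_A: "keep_rows n \<eta> \<in> A_set"
    and height_keep_rows: "height (keep_rows n \<eta>) =
      (\<lambda>x. if x \<le> int n + 1 then height \<eta> (x - (int n + 1) + particle n \<eta>) else x - 1)"
proof -
  let ?h = "\<lambda>x. if x \<le> int n + 1 then height \<eta> (x - (int n + 1) + particle n \<eta>) else x - 1"
  obtain N where N: "\<forall>x\<le>N. height \<eta> x = 0" using height_eventually_0[OF assms] by blast
  have 1: "\<forall>x\<le>min N (int n + 1). ?h x = 0" using N particle_le[OF assms, of n] by auto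
  have 3: "\<forall>x\<ge>int n + 2. ?h x = x - 1" by auto
  have 2: "?h (x + 1) = ?h x + of_bool (keep_rows n \<eta> x)" for x
    using height_Suc[OF assms, of "x - (int n + 1) + particle n \<eta>"] particle(1)[OF assms, of n]
    by (cases "x = int n + 1") (auto simp: keep_rows_def algebra_simps)
  show "keep_rows n \<eta> \<in> A_set" "height (keep_rows n \<eta>) = ?h"
    using A_heightI[where h = ?h, OF 1 2 3] by blast+
qed

text \<open>The truncation translates by \<open>int n + 1 - particle n \<eta>\<close>, which is
  nonnegative, and a shift to the right lowers heights. Beyond n + 1 the height takes its least
  possible value.\<close>

lemma height_keep_rows_le:
  assumes "\<eta> \<in> A_set"
  shows "height (keep_rows n \<eta>) x \<le> height \<eta> x"
  using height_mono[OF assms, of "x - (int n + 1) + particle n \<eta>" x] particle_le[OF assms, of n]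
    height_ge_ground[OF assms, of x]
  by (auto simp: height_keep_rows[OF assms])

lemma keep_rows_0:
  assumes "\<eta> \<in> A_set"
  shows "keep_rows 0 \<eta> = (\<lambda>x. x > 0)"
proof -
  have "\<not> \<eta> y" if "y < particle 0 \<eta>" for y
    using height_mono[OF assms, of "y + 1" "particle 0 \<eta>"] particle(1)[OF assms, of 0]
      height_Suc[OF assms, of y] height_nonneg[OF assms, of y] that by (auto split: if_splits)
  then have "\<not> \<eta> (x - 1 + particle 0 \<eta>)" if "x \<le> 0" for x
    using that by simp
  then show ?thesis by (auto simp: keep_rows_def fun_eq_iff not_less[symmetric])
qed

lemma keep_rows_full:
  assumes "\<eta> \<in> A_set" "\<forall>x>int n. \<eta> x"
  shows "keep_rows n \<eta> = \<eta>"
proof -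
  have "particle n \<eta> = int n + 1"
    using assms by (intro particle_eqI) (auto simp: height_full)
  with assms(2) show ?thesis by (auto simp: keep_rows_def fun_eq_iff)
qed

lemma keep_rows_Suc:
  assumes "\<eta> \<in> A_set"
  shows "keep_rows n (keep_rows (Suc n) \<eta>) = keep_rows n \<eta>"
proof -
  \<comment> \<open>The distance by which \<open>keep_rows (Suc n)\<close> translates to the right;
    particle n moves along with it.\<close>
  let ?c = "int n + 2 - particle (Suc n) \<eta>"
  have less: "particle n \<eta> < particle (Suc n) \<eta>"
    using height_mono[OF assms, of "particle (Suc n) \<eta>" "particle n \<eta>"]
      particle(1)[OF assms, of n] particle(1)[OF assms, of "Suc n"]
    by (cases "particle n \<eta> < particle (Suc n) \<eta>") auto
  then have "height (keep_rows (Suc n) \<eta>) (particle n \<eta> + ?c) = int n"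
    using particle[OF assms, of n] by (simp add: height_keep_rows[OF assms] algebra_simps)
  moreover have "keep_rows (Suc n) \<eta> (particle n \<eta> + ?c)"
    using particle[OF assms, of n] by (simp add: keep_rows_def)
  ultimately have "particle n (keep_rows (Suc n) \<eta>) = particle n \<eta> + ?c"
    by (intro particle_eqI keep_rows_in_A[OF assms])
  with less show ?thesis
    by (auto simp: keep_rows_def fun_eq_iff algebra_simps)
qed

text \<open>\<open>bubble (int n + 1)\<close> adds a column of length
  \<open>height \<eta> (int n + 2)\<close>, which is at least n + 1, and \<open>keep_rows n\<close>
  deletes it.\<close>

lemma keep_rows_bubble:
  assumes "\<eta> \<in> A_set"
  shows "keep_rows n (bubble (int n + 1) \<eta>) = keep_rows n \<eta>"
proof -
  have "height (bubble (int n + 1) \<eta>) (particle n \<eta> - 1) = int n"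
    using particle[OF assms, of n] particle_le[OF assms, of n] by (simp add: height_bubble[OF assms])
  moreover have "bubble (int n + 1) \<eta> (particle n \<eta> - 1)"
    using particle[OF assms, of n] particle_le[OF assms, of n] by (simp add: bubble_def)
  ultimately have "particle n (bubble (int n + 1) \<eta>) = particle n \<eta> - 1"
    by (intro particle_eqI bubble_in_A[OF assms])
  then show ?thesis
    using particle_le[OF assms, of n] by (auto simp: keep_rows_def bubble_def fun_eq_iff algebra_simps)
qed

lemma particle_swap_config:
  assumes "\<eta> \<in> A_set" "l + 1 < particle n \<eta>"
  shows "particle n (swap_config l \<eta>) = particle n \<eta>"
  using particle[OF assms(1), of n] assms(2)
  by (intro particle_eqI) (auto simp: assms(1) height_swap_config[OF assms(1)] swap_config_apply)

lemma keep_rows_swap_config: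
  assumes "\<eta> \<in> A_set" "k < int n"
  shows "keep_rows n (swap_config (k - (int n + 1) + particle n \<eta>) \<eta>) = swap_config k (keep_rows n \<eta>)"
proof -
  have "particle n (swap_config (k - (int n + 1) + particle n \<eta>) \<eta>) = particle n \<eta>"
    using assms by (intro particle_swap_config) auto
  with assms(2) show ?thesis
    by (auto simp: keep_rows_def swap_config_apply fun_eq_iff algebra_simps)
qed

lemma measure_pmf_bij_betw:
  assumes "bij_betw g A B" "\<And>x. x \<in> A \<Longrightarrow> pmf p (g x) = c * pmf p x" "0 \<le> c"
  shows "measure (measure_pmf p) B = c * measure (measure_pmf p) A"
proof -
  have "emeasure (measure_pmf p) B = (\<integral>\<^sup>+ x. pmf p (g x) \<partial>count_space A)"
    using nn_integral_bij_count_space[OF assms(1), of "\<lambda>x. ennreal (pmf p x)"] by (simp add: nn_integral_pmf)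
  also have "\<dots> = (\<integral>\<^sup>+ x. ennreal c * pmf p x \<partial>count_space A)"
    using assms(2,3) by (intro nn_integral_cong) (simp add: ennreal_mult')
  also have "\<dots> = ennreal c * emeasure (measure_pmf p) A"
    by (simp add: nn_integral_cmult nn_integral_pmf)
  finally show ?thesis
    using assms(3) by (simp add: measure_pmf.emeasure_eq_measure flip: ennreal_mult')
qed

text \<open>The coupling argument sees the blocking measure only through its support and detailed
  balance, so it can precede the construction of the measure as a mass function.\<close>

locale blocking = asym +
  fixes \<pi> :: "config pmf"
  assumes support: "set_pmf \<pi> \<subseteq> A_set"
    and balanced_blocking: "balanced k (pmf \<pi>)"
begin

text \<open>The blocking measure of \<open>n\<close> particles with all sites to the right of \<open>n\<close> filled. It could also
  be obtained from \<open>\<pi>\<close> by conditioning, but as an image of \<open>\<pi>\<close> it is dominated by \<open>\<pi>\<close> for free.\<close>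

definition base :: "nat \<Rightarrow> config pmf" where
  "base n = map_pmf (keep_rows n) \<pi>"

lemma set_base:
  assumes "\<xi> \<in> set_pmf (base n)"
  shows "\<xi> \<in> A_set" "\<forall>x>int n. \<xi> x"
  using assms support by (auto simp: base_def keep_rows_in_A) (simp add: keep_rows_def)

lemma pmf_base_eq_0: "\<not> (\<xi> \<in> A_set \<and> (\<forall>x>int n. \<xi> x)) \<Longrightarrow> pmf (base n) \<xi> = 0"
  using set_base by (metis set_pmf_iff)

lemma base_0: "base 0 = return_pmf (\<lambda>x. x > 0)"
proof -
  have "base 0 = map_pmf (\<lambda>_. \<lambda>x. x > 0) \<pi>"
    unfolding base_def using support by (intro map_pmf_cong) (auto simp: keep_rows_0)
  then show ?thesis by simp
qed

lemma base_keep_rows: "base n = map_pmf (keep_rows n) (base (Suc n))"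
  unfolding base_def map_pmf_comp using support
  by (intro map_pmf_cong) (auto simp: keep_rows_Suc)

text \<open>For k > n both configurations have a hole beyond n and mass 0. For k < n the swap lifts
  to a bijection between the fibres of \<open>keep_rows n\<close>, which multiplies the mass under
  \<pi> by q.\<close>

lemma balanced_base:
  assumes "k \<noteq> int n"
  shows "balanced k (pmf (base n))"
  unfolding balanced_def
proof (intro allI impI)
  fix \<xi> :: config
  assume \<xi>: "\<not> \<xi> k" "\<xi> (k + 1)"
  show "pmf (base n) (swap_config k \<xi>) = q * pmf (base n) \<xi>"
  proof (cases "k > int n")
    case True
    with \<xi> have "pmf (base n) \<xi> = 0" by (intro pmf_base_eq_0) blast
    moreover have "\<not> swap_config k \<xi> (k + 1)" "k + 1 > int n"
      using \<xi> True by (auto simp: swap_config_apply)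
    then have "pmf (base n) (swap_config k \<xi>) = 0" by (intro pmf_base_eq_0) blast
    ultimately show ?thesis by simp
  next
    case False
    with assms have k: "k < int n" by simp
    define F where "F \<zeta> = {\<eta> \<in> A_set. keep_rows n \<eta> = \<zeta>}" for \<zeta>
    \<comment> \<open>The site of \<eta> that the translation carries to k. It depends on \<eta>,
      but lies left of particle n and is unchanged by the swap, so swapping there is an
      involution.\<close>
    define l where "l \<eta> = k - (int n + 1) + particle n \<eta>" for \<eta>
    have pmf_F: "pmf (base n) \<zeta> = measure (measure_pmf \<pi>) (F \<zeta>)" for \<zeta>
      unfolding base_def pmf_map F_def using support
      by (intro measure_pmf.finite_measure_eq_AE AE_pmfI) auto
    have l: "l (swap_config (l \<eta>) \<eta>) = l \<eta>" if "\<eta> \<in> A_set" for \<eta>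
      using particle_swap_config[OF that, of "l \<eta>"] k by (simp add: l_def)
    have F: "swap_config (l \<eta>) \<eta> \<in> F (swap_config k \<zeta>)" if "\<eta> \<in> F \<zeta>" for \<eta> \<zeta>
      using that keep_rows_swap_config[OF _ k, of \<eta>] by (simp add: F_def l_def)
    have "bij_betw (\<lambda>\<eta>. swap_config (l \<eta>) \<eta>) (F \<xi>) (F (swap_config k \<xi>))"
    proof (rule bij_betw_byWitness[where f' = "\<lambda>\<eta>. swap_config (l \<eta>) \<eta>"])
      show "(\<lambda>\<eta>. swap_config (l \<eta>) \<eta>) ` F (swap_config k \<xi>) \<subseteq> F \<xi>"
        using F[of _ "swap_config k \<xi>"] by auto
    qed (use F in \<open>auto simp: F_def l\<close>)
    moreover have "pmf \<pi> (swap_config (l \<eta>) \<eta>) = q * pmf \<pi> \<eta>" if "\<eta> \<in> F \<xi>" for \<eta>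
      using that \<xi> k balanced_blocking[of "l \<eta>"]
      by (auto simp: F_def l_def balanced_def keep_rows_def algebra_simps)
    ultimately show ?thesis
      unfolding pmf_F using q by (intro measure_pmf_bij_betw[where c = q]) auto
  qed
qed

lemma T_base: "k \<noteq> int n \<Longrightarrow> T k (base n) = base n"
  by (intro T_balanced balanced_base)

text \<open>Moving the empty site below the leftmost particle step by step to \<open>m\<close> shifts all
  \<open>height \<eta> (m + 1)\<close> particles up to \<open>m\<close> to the left.\<close>

lemma balanced_bubble:
  assumes f: "\<And>k. k < m \<Longrightarrow> balanced k f" and \<eta>: "\<eta> \<in> A_set"
  shows "f (bubble m \<eta>) = q ^ nat (height \<eta> (m + 1)) * f \<eta>"
proof -
  obtain N where N: "\<forall>x\<le>N. height \<eta> x = 0" using height_eventually_0[OF \<eta>] by blast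
  \<comment> \<open>Far enough to the left of all particles that inserting a hole at a changes
    nothing.\<close>
  define a where "a = min (N - 2) m"
  have empty: "\<not> \<eta> x" if "x < N" for x
    using N height_Suc[OF \<eta>, of x] that by (auto split: if_splits)
  have "i \<le> m \<longrightarrow> f (bubble i \<eta>) = q ^ nat (height \<eta> (i + 1)) * f \<eta>" if "a \<le> i" for i
    using that
  proof (induction i rule: int_ge_induct)
    case base
    have "bubble a \<eta> = \<eta>"
      using empty by (auto simp: bubble_def a_def fun_eq_iff)
    with N show ?case by (simp add: a_def)
  next
    case (step i)
    have sw: "bubble (i + 1) \<eta> = swap_config i (bubble i \<eta>)"
      by (auto simp: bubble_def swap_config_apply fun_eq_iff)
    show ?case
    proof
      assume "i + 1 \<le> m"
      with step.IH have IH: "f (bubble i \<eta>) = q ^ nat (height \<eta> (i + 1)) * f \<eta>" by simp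
      have vals: "\<not> bubble i \<eta> i" "bubble i \<eta> (i + 1) = \<eta> (i + 1)" by (auto simp: bubble_def)
      show "f (bubble (i + 1) \<eta>) = q ^ nat (height \<eta> (i + 1 + 1)) * f \<eta>"
      proof (cases "\<eta> (i + 1)")
        case True
        then have "f (bubble (i + 1) \<eta>) = q * f (bubble i \<eta>)"
          using f[of i] \<open>i + 1 \<le> m\<close> vals by (auto simp: sw balanced_def)
        with True IH show ?thesis
          using height_Suc[OF \<eta>, of "i + 1"] height_nonneg[OF \<eta>, of "i + 1"]
          by (simp add: nat_add_distrib)
      next
        case False
        with vals have "bubble (i + 1) \<eta> = bubble i \<eta>" by (simp add: sw swap_config_same)
        with False IH show ?thesis using height_Suc[OF \<eta>, of "i + 1"] by simp
      qed
    qed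
  qed
  from this[of m] show ?thesis by (simp add: a_def)
qed

text \<open>Thus \<open>base j\<close> is \<open>base (Suc j)\<close> conditioned on a particle at j
  + 1. The fibre of \<open>keep_rows j\<close> over \<xi> consists of \<xi> and the image of the
  fibre under \<open>bubble (int j + 1)\<close>, which multiplies masses by q^(j+1). Its total mass
  therefore solves a geometric-series equation.\<close>

lemma pmf_base_Suc:
  "pmf (base j) \<xi> = (if \<xi> (int j + 1) then pmf (base (Suc j)) \<xi> / (1 - q ^ Suc j) else 0)"
proof (cases "\<xi> \<in> A_set \<and> (\<forall>x>int j. \<xi> x)")
  case False
  have "pmf (base (Suc j)) \<xi> = 0" if "\<xi> (int j + 1)"
  proof (rule pmf_base_eq_0, rule notI)
    assume *: "\<xi> \<in> A_set \<and> (\<forall>x>int (Suc j). \<xi> x)"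
    have "\<xi> x" if "x > int j" for x
      using * \<open>\<xi> (int j + 1)\<close> that by (cases "x = int j + 1") auto
    with * False show False by blast
  qed
  with False show ?thesis by (simp add: pmf_base_eq_0)
next
  case True
  let ?p = "base (Suc j)" and ?b = "bubble (int j + 1)"
  define F where "F = {\<zeta> \<in> A_set. (\<forall>x>int (Suc j). \<zeta> x) \<and> keep_rows j \<zeta> = \<xi>}"
  have "pmf (base j) \<xi> = measure (measure_pmf ?p) F"
    unfolding base_keep_rows[of j] pmf_map F_def using set_base[of _ "Suc j"]
    by (intro measure_pmf.finite_measure_eq_AE AE_pmfI) auto
  moreover have "F = insert \<xi> (?b ` F)"
  proof (intro equalityI subsetI)
    fix \<zeta> assume \<zeta>: "\<zeta> \<in> F"
    show "\<zeta> \<in> insert \<xi> (?b ` F)"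
    proof (cases "\<zeta> (int j + 1)")
      case True
      have "\<zeta> x" if "x > int j" for x
        using \<zeta> True that by (cases "x = int j + 1") (auto simp: F_def)
      with \<zeta> show ?thesis using keep_rows_full[of \<zeta> j] by (auto simp: F_def)
    next
      case False
      then have b: "?b (unbubble (int j + 1) \<zeta>) = \<zeta>" by (rule bubble_unbubble)
      have "unbubble (int j + 1) \<zeta> \<in> A_set" using \<zeta> False by (intro unbubble_A) (auto simp: F_def)
      moreover have "keep_rows j (unbubble (int j + 1) \<zeta>) = \<xi>"
        using keep_rows_bubble[OF calculation, of j] \<zeta> by (simp add: b F_def)
      ultimately have "unbubble (int j + 1) \<zeta> \<in> F" using \<zeta> by (auto simp: F_def unbubble_def)
      with b show ?thesis by (metis imageI insertCI)
    qed
  next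
    have "?b \<zeta> \<in> F" if "\<zeta> \<in> F" for \<zeta>
      using that bubble_in_A[of \<zeta> "int j + 1"] keep_rows_bubble[of \<zeta> j]
      by (auto simp: F_def) (simp add: bubble_def)
    moreover have "\<xi> \<in> F" using True keep_rows_full[of \<xi> j] by (auto simp: F_def)
    moreover fix \<zeta> assume "\<zeta> \<in> insert \<xi> (?b ` F)"
    ultimately show "\<zeta> \<in> F" by auto
  qed
  moreover have "measure (measure_pmf ?p) (insert \<xi> (?b ` F)) =
      pmf ?p \<xi> + measure (measure_pmf ?p) (?b ` F)"
  proof -
    have "\<not> ?b \<zeta> (int j + 1)" for \<zeta> by (simp add: bubble_def)
    moreover have "\<xi> (int j + 1)" using True by simp
    ultimately have "\<xi> \<notin> ?b ` F" by blast
    then show ?thesis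
      using measure_pmf.finite_measure_Union[of "{\<xi>}" ?p "?b ` F"] by (simp add: measure_pmf_single)
  qed
  moreover have "measure (measure_pmf ?p) (?b ` F) = q ^ Suc j * measure (measure_pmf ?p) F"
  proof (rule measure_pmf_bij_betw)
    show "bij_betw ?b F (?b ` F)"
      by (intro inj_on_imp_bij_betw inj_onI) (metis unbubble_bubble)
    fix \<zeta> assume "\<zeta> \<in> F"
    then have "height \<zeta> (int j + 1 + 1) = int (Suc j)" "\<zeta> \<in> A_set"
      using height_full[of \<zeta> "int (Suc j)" "int j + 1 + 1"] by (auto simp: F_def)
    moreover have "pmf ?p (?b \<zeta>) = q ^ nat (height \<zeta> (int j + 1 + 1)) * pmf ?p \<zeta>"
      by (rule balanced_bubble) (auto intro: balanced_base calculation)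
    ultimately show "pmf ?p (?b \<zeta>) = q ^ Suc j * pmf ?p \<zeta>" by (simp only: nat_int)
  qed (use q in auto)
  ultimately have "pmf (base j) \<xi> = pmf ?p \<xi> + q ^ Suc j * pmf (base j) \<xi>" by metis
  moreover have "q ^ Suc j < 1" using q by (intro power_Suc_less_one)
  ultimately show ?thesis using True by (simp add: field_simps)
qed

text \<open>On the support the exponent is the number of particles at sites m + 1 to j + 1. The
  induction runs downwards from \<open>pmf_base_Suc\<close>: every new letter is at most j, where
  \<open>base (Suc j)\<close> is balanced, so \<open>T\<close> acts on the density alone.\<close>

lemma pmf_partial_row:
  assumes "m \<le> int j + 1"
  shows "pmf (foldr T [m..int j] (base j)) \<xi> = pmf (base (Suc j)) \<xi> *
    ((if \<xi> m then 1 else 1 - q ^ nat (int (Suc j) - height \<xi> (m + 1))) / (1 - q ^ Suc j))"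
  using assms
proof (induction m arbitrary: \<xi> rule: int_le_induct)
  case base
  show ?case
  proof (cases "\<xi> \<in> A_set \<and> (\<forall>x>int (Suc j). \<xi> x)")
    case True
    then have "height \<xi> (int j + 1 + 1) = int (Suc j)"
      using height_full[of \<xi> "int (Suc j)" "int j + 1 + 1"] by simp
    then show ?thesis by (simp add: pmf_base_Suc[of j])
  next
    case False
    then show ?thesis by (simp add: pmf_base_Suc[of j] pmf_base_eq_0)
  qed
next
  case (step m)
  define k where "k = m - 1"
  define g where "g m \<xi> = (if \<xi> m then 1 else 1 - q ^ nat (int (Suc j) - height \<xi> (m + 1))) / (1 - q ^ Suc j)"
    for m \<xi>
  have upto: "[k..int j] = k # [m..int j]" using step.hyps by (simp add: k_def upto_rec1)
  have bal: "balanced k (pmf (base (Suc j)))"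
    using step.hyps by (intro balanced_base) (simp add: k_def)
  have "pmf (foldr T [m..int j] (base j)) = (\<lambda>\<eta>. pmf (base (Suc j)) \<eta> * g m \<eta>)"
    unfolding g_def by (rule ext) (rule step.IH)
  then have "pmf (foldr T [k..int j] (base j)) \<xi> = Tm k (\<lambda>\<eta>. pmf (base (Suc j)) \<eta> * g m \<eta>) \<xi>"
    by (simp add: upto pmf_T)
  also have "\<dots> = pmf (base (Suc j)) \<xi> *
      ((1 - swap_rate q 1 k \<xi>) * g m \<xi> + swap_rate q 1 k \<xi> * g m (swap_config k \<xi>))"
    by (rule Tm_balanced_mult[OF bal])
  also have "\<dots> = pmf (base (Suc j)) \<xi> * g k \<xi>"
  proof (cases "\<xi> \<in> A_set \<and> (\<forall>x>int (Suc j). \<xi> x)")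
    case True
    then have A: "\<xi> \<in> A_set" by simp
    have "height \<xi> (m + 1) \<le> height \<xi> (int j + 2)"
      using step.hyps by (intro height_mono[OF A]) simp
    also have "\<dots> = int (Suc j)"
      using True height_full[of \<xi> "int (Suc j)" "int j + 2"] by simp
    finally have le: "height \<xi> (m + 1) \<le> int (Suc j)" .
    define N where "N = nat (int (Suc j) - height \<xi> (m + 1))"
    have N: "nat (int (Suc j) - height \<xi> m) = (if \<xi> m then Suc N else N)"
      using height_Suc[OF A, of m] le by (auto simp: N_def Suc_nat_eq_nat_zadd1)
    have "g m \<xi> = (if \<xi> m then 1 else 1 - q ^ N) / (1 - q ^ Suc j)"
      "g m (swap_config k \<xi>) = (if \<xi> k then 1 else 1 - q ^ N) / (1 - q ^ Suc j)"
      "g k \<xi> = (if \<xi> k then 1 else 1 - q ^ (if \<xi> m then Suc N else N)) / (1 - q ^ Suc j)"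
      unfolding N[symmetric] by (auto simp: g_def N_def k_def swap_config_apply height_swap_config[OF A])
    then have "(1 - swap_rate q 1 k \<xi>) * g m \<xi> + swap_rate q 1 k \<xi> * g m (swap_config k \<xi>) = g k \<xi>"
      by (simp add: swap_rate_def k_def diff_divide_distrib algebra_simps)
    then show ?thesis by simp
  next
    case False
    then show ?thesis by (simp add: pmf_base_eq_0)
  qed
  finally show ?case by (simp add: k_def g_def)
qed

end

section \<open>The coupling\<close>

lemma bubble_funpow:
  assumes "\<eta> \<in> A_set"
  shows bubble_funpow_in_A: "(bubble m ^^ d) \<eta> \<in> A_set"
    and height_bubble_funpow: "height ((bubble m ^^ d) \<eta>) (m + 1) = height \<eta> (m + 1)"
    and height_bubble_funpow_le: "height \<eta> x \<le> height ((bubble m ^^ d) \<eta>) x"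
proof -
  have "(bubble m ^^ d) \<eta> \<in> A_set \<and> height ((bubble m ^^ d) \<eta>) (m + 1) = height \<eta> (m + 1) \<and>
    (\<forall>x. height \<eta> x \<le> height ((bubble m ^^ d) \<eta>) x)"
  proof (induction d)
    case (Suc d)
    define \<zeta> where "\<zeta> = (bubble m ^^ d) \<eta>"
    from Suc have \<zeta>: "\<zeta> \<in> A_set" "height \<zeta> (m + 1) = height \<eta> (m + 1)" "\<And>x. height \<eta> x \<le> height \<zeta> x"
      by (auto simp: \<zeta>_def)
    have "height \<eta> x \<le> height (bubble m \<zeta>) x" for x
      using height_mono[OF \<zeta>(1), of x "x + 1"] \<zeta>(3)[of x] by (auto simp: height_bubble[OF \<zeta>(1)])
    then show ?case
      using bubble_in_A[OF \<zeta>(1), of m] \<zeta>(2)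
      by (simp add: height_bubble[OF \<zeta>(1)] flip: \<zeta>_def)
  qed (use assms in auto)
  then show "(bubble m ^^ d) \<eta> \<in> A_set" "height ((bubble m ^^ d) \<eta>) (m + 1) = height \<eta> (m + 1)"
    "height \<eta> x \<le> height ((bubble m ^^ d) \<eta>) x" by auto
qed

lemma bubble_funpow_right: "m < x \<Longrightarrow> (bubble m ^^ d) \<eta> x = \<eta> x"
  by (induction d) (auto simp: bubble_def)

text \<open>Every application of \<open>bubble m\<close> empties site m, so a configuration with m
  occupied is the starting point of its orbit, and equal powers can be cancelled one by one.\<close>

lemma bubble_funpow_eqD:
  assumes "(bubble m ^^ d) \<xi> = (bubble m ^^ e) \<zeta>" "\<xi> m" "\<zeta> m"
  shows "d = e \<and> \<xi> = \<zeta>"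
  using assms(1)
proof (induction d arbitrary: e)
  case 0
  with assms(2) show ?case by (cases e) (auto simp: bubble_def)
next
  case (Suc d)
  show ?case
  proof (cases e)
    case 0
    with Suc.prems assms(3) have "bubble m ((bubble m ^^ d) \<xi>) m" by simp
    then show ?thesis by (simp add: bubble_def)
  next
    case (Suc e')
    with Suc.prems have "(bubble m ^^ d) \<xi> = (bubble m ^^ e') \<zeta>"
      by (simp, metis unbubble_bubble)
    with Suc.IH Suc show ?thesis by blast
  qed
qed

text \<open>The shifts are undone until a particle arrives at m; positive height at m + 1 provides
  one at or to the left of m.\<close>

lemma bubble_funpow_preimage:
  assumes "\<eta> \<in> A_set" "0 < height \<eta> (m + 1)"
  shows "\<exists>\<xi> d. \<xi> \<in> A_set \<and> \<xi> m \<and> (bubble m ^^ d) \<xi> = \<eta>"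
proof -
  have "\<exists>e. \<eta> (m - int e)"
  proof (rule ccontr)
    assume *: "\<nexists>e. \<eta> (m - int e)"
    have "\<not> \<eta> x" if "x \<le> m" for x
      using * that by (metis diff_diff_eq2 add_diff_cancel_left' zle_iff_zadd)
    moreover obtain N where N: "height \<eta> x = 0" if "x \<le> N" for x
      using height_eventually_0[OF assms(1)] by blast
    ultimately have empty: "{x. min N m \<le> x \<and> x < m + 1 \<and> \<eta> x} = {}" by force
    have "height \<eta> (m + 1) - height \<eta> (min N m) = int (card {x. min N m \<le> x \<and> x < m + 1 \<and> \<eta> x})"
      by (rule increments_sum[where h = "height \<eta>", OF height_Suc[OF assms(1)]]) simp
    then show False
      unfolding empty using N[of "min N m"] assms(2) by simp
  qed
  then obtain e where "\<eta> (m - int e)" by blast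
  with assms(1) show ?thesis
  proof (induction e arbitrary: \<eta>)
    case 0
    then show ?case by (intro exI[of _ \<eta>] exI[of _ 0]) auto
  next
    case (Suc e)
    show ?case
    proof (cases "\<eta> m")
      case True
      with Suc.prems show ?thesis by (intro exI[of _ \<eta>] exI[of _ 0]) auto
    next
      case False
      have "unbubble m \<eta> (m - int e)"
        using Suc.prems by (simp add: unbubble_def algebra_simps)
      from Suc.IH[OF unbubble_A[OF Suc.prems(1) False] this]
      obtain \<xi> d where "\<xi> \<in> A_set" "\<xi> m" "(bubble m ^^ d) \<xi> = unbubble m \<eta>" by blast
      with False show ?thesis
        by (intro exI[of _ \<xi>] exI[of _ "Suc d"]) (simp add: bubble_unbubble)
    qed
  qed
qed

definition height_le :: "config \<Rightarrow> config \<Rightarrow> bool" where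
  "height_le \<xi> \<eta> \<longleftrightarrow> \<xi> \<in> A_set \<and> \<eta> \<in> A_set \<and> (\<forall>x. height \<xi> x \<le> height \<eta> x)"

definition height_le_eq_right :: "int \<Rightarrow> config \<Rightarrow> config \<Rightarrow> bool" where
  "height_le_eq_right m \<xi> \<eta> \<longleftrightarrow> height_le \<xi> \<eta> \<and> (\<forall>x>m. \<xi> x = \<eta> x)"

context blocking
begin

text \<open>Both configurations agree at k and k + 1, so one coin serves both. The only changed
  height, at k + 1, becomes the height at k plus a common increment.\<close>

lemma rel_pmf_T:
  assumes "rel_pmf (height_le_eq_right m) p p'" "m < k"
  shows "rel_pmf (height_le_eq_right m) (T k p) (T k p')"
  unfolding op_pmf_def
proof (rule rel_pmf_bindI[OF assms(1)])
  fix \<xi> \<eta> assume *: "height_le_eq_right m \<xi> \<eta>"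
  then have "swap_rate q 1 k \<xi> = swap_rate q 1 k \<eta>"
    using assms(2) by (simp add: swap_rate_def height_le_eq_right_def)
  moreover have "height_le_eq_right m (swap_config k \<xi>) (swap_config k \<eta>)"
    using * assms(2)
    by (auto simp: height_le_eq_right_def height_le_def height_swap_config swap_config_apply)
  ultimately show "rel_pmf (height_le_eq_right m) (step_pmf q 1 k \<xi>) (step_pmf q 1 k \<eta>)"
    using * unfolding step_pmf_def by (auto simp: pmf.rel_map intro!: rel_pmf_reflI)
qed

lemma rel_pmf_foldr_T:
  assumes "rel_pmf (height_le_eq_right m) p p'" "\<forall>k\<in>set v. m < k"
  shows "rel_pmf (height_le_eq_right m) (foldr T v p) (foldr T v p')"
  using assms(2) by (induction v) (auto intro: assms(1) rel_pmf_T)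

text \<open>Shifting the particles up to \<open>m\<close> to the left by a number of steps with this law transports the law with density given by
  \<open>pmf_partial_row\<close> to \<open>base (Suc j)\<close>.\<close>

definition shift_law :: "nat \<Rightarrow> nat \<Rightarrow> nat pmf" where
  "shift_law j l = mix_pmf (q ^ Suc j) (map_pmf Suc (geometric_pmf (1 - q ^ l))) (return_pmf 0)"

text \<open>The density in \<open>pmf_partial_row\<close> is too large exactly where m is occupied,
  that is, at the starting points of the orbits of \<open>bubble m\<close>. Mass moves from there
  along the orbit and stays put everywhere else.\<close>

definition shift_left :: "nat \<Rightarrow> int \<Rightarrow> config \<Rightarrow> config pmf" where
  "shift_left j m \<xi> = (if \<xi> m
     then map_pmf (\<lambda>d. (bubble m ^^ d) \<xi>) (shift_law j (nat (height \<xi> (m + 1))))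
     else return_pmf \<xi>)"

lemma q_power: "0 < q ^ n" "q ^ Suc n < 1" "q ^ n \<le> 1"
  using q by (auto intro: power_Suc_less_one power_le_one less_imp_le simp del: power_Suc)

lemma pmf_shift_law_0: "pmf (shift_law j l) 0 = 1 - q ^ Suc j"
  unfolding shift_law_def
  by (subst pmf_mix_pmf)
    (use q_power in \<open>auto simp: pmf_map_outside simp del: power_Suc intro: less_imp_le\<close>)

lemma pmf_shift_law_Suc:
  assumes "0 < l"
  shows "pmf (shift_law j l) (Suc d) = q ^ Suc j * (q ^ (l * d) * (1 - q ^ l))"
proof -
  obtain l' where l: "l = Suc l'" using assms by (cases l) auto
  have "pmf (map_pmf Suc (geometric_pmf (1 - q ^ l))) (Suc d) = q ^ (l * d) * (1 - q ^ l)"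
    using q_power(1)[of l] q_power(2)[of l', folded l]
    by (subst pmf_map_inj') (auto simp: power_mult)
  then show ?thesis
    unfolding shift_law_def using q_power[of "Suc j"] q_power[of j]
    by (subst pmf_mix_pmf) (auto simp del: power_Suc)
qed

lemma pmf_shift_left:
  assumes "\<xi> m"
  shows "pmf (shift_left j m \<xi>) ((bubble m ^^ d) \<xi>) = pmf (shift_law j (nat (height \<xi> (m + 1)))) d"
proof -
  have "inj (\<lambda>d. (bubble m ^^ d) \<xi>)"
    using bubble_funpow_eqD assms by (intro injI) blast
  from pmf_map_inj'[OF this, where x = d] show ?thesis using assms by (simp add: shift_left_def)
qed

lemma set_shift_left:
  assumes "\<eta> \<in> set_pmf (shift_left j m \<xi>)"
  shows "\<exists>d. \<eta> = (bubble m ^^ d) \<xi> \<and> (d = 0 \<or> \<xi> m)"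
  using assms by (auto simp: shift_left_def split: if_splits intro: exI[of _ 0])

lemma pmf_base_bubble_funpow:
  assumes "m \<le> int j + 1" "\<xi> \<in> A_set"
  shows "pmf (base (Suc j)) ((bubble m ^^ d) \<xi>) =
    q ^ (nat (height \<xi> (m + 1)) * d) * pmf (base (Suc j)) \<xi>"
proof (induction d)
  case (Suc d)
  have "pmf (base (Suc j)) (bubble m ((bubble m ^^ d) \<xi>)) =
      q ^ nat (height ((bubble m ^^ d) \<xi>) (m + 1)) * pmf (base (Suc j)) ((bubble m ^^ d) \<xi>)"
    using assms by (intro balanced_bubble balanced_base bubble_funpow_in_A) auto
  with Suc show ?case by (simp add: height_bubble_funpow[OF assms(2)] power_add)
qed simp

text \<open>With m occupied, \<eta> receives mass only from itself and keeps the fraction 1 - Q of a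
  density 1 / (1 - Q). With m empty, it keeps all its mass and also receives some from the start
  \<zeta> of its orbit, if there is one.\<close>

lemma bind_shift_left:
  assumes m: "m \<le> int j + 1"
  shows "bind_pmf (foldr T [m..int j] (base j)) (shift_left j m) = base (Suc j)"
proof (rule pmf_eqI)
  fix \<eta>
  define S where "S = foldr T [m..int j] (base j)"
  define Q where "Q = q ^ Suc j"
  have Q: "Q < 1" unfolding Q_def by (rule q_power)
  have S: "pmf S \<xi> = pmf (base (Suc j)) \<xi> *
    ((if \<xi> m then 1 else 1 - q ^ nat (int (Suc j) - height \<xi> (m + 1))) / (1 - Q))" for \<xi>
    unfolding S_def Q_def by (rule pmf_partial_row[OF m])
  have supp: "\<xi> \<in> A_set" "\<forall>x>int (Suc j). \<xi> x" if "\<xi> \<in> set_pmf S" for \<xi>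
    using that pmf_base_eq_0[of \<xi> "Suc j"] by (auto simp: set_pmf_iff S)
  have "pmf (bind_pmf S (shift_left j m)) \<eta> = pmf (base (Suc j)) \<eta>"
  proof (cases "\<eta> \<in> A_set \<and> (\<forall>x>int (Suc j). \<eta> x)")
    case False
    have "\<eta> \<notin> set_pmf (bind_pmf S (shift_left j m))"
    proof
      assume "\<eta> \<in> set_pmf (bind_pmf S (shift_left j m))"
      then obtain \<xi> d where "\<xi> \<in> set_pmf S" "\<eta> = (bubble m ^^ d) \<xi>"
        using set_shift_left by (auto, blast)
      with supp[of \<xi>] m False show False
        by (auto simp: bubble_funpow_in_A bubble_funpow_right)
    qed
    then have "pmf (bind_pmf S (shift_left j m)) \<eta> = 0" by (simp add: set_pmf_iff del: set_bind_pmf)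
    with False show ?thesis by (simp add: pmf_base_eq_0)
  next
    case True
    then have A: "\<eta> \<in> A_set" by simp
    have sum: "pmf (bind_pmf S (shift_left j m)) \<eta> = (\<Sum>\<xi>\<in>C. pmf (shift_left j m \<xi>) \<eta> * pmf S \<xi>)"
      if "finite C" "\<And>\<xi> d. \<eta> = (bubble m ^^ d) \<xi> \<Longrightarrow> d = 0 \<or> \<xi> m \<Longrightarrow> \<xi> \<in> S \<Longrightarrow> \<xi> \<in> C" for C
      unfolding pmf_bind
    proof (rule integral_measure_pmf_real)
      fix \<xi> assume "\<xi> \<in> set_pmf S" "pmf (shift_left j m \<xi>) \<eta> \<noteq> 0"
      then show "\<xi> \<in> C"
        using that(2) set_shift_left[of \<eta> j m \<xi>] by (auto simp: set_pmf_iff)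
    qed fact
    show ?thesis
    proof (cases "\<eta> m")
      case True
      have "\<xi> = \<eta>" if "\<eta> = (bubble m ^^ d) \<xi>" "d = 0 \<or> \<xi> m" for \<xi> d
        using that True by (cases d) (auto simp: bubble_def)
      then have "pmf (bind_pmf S (shift_left j m)) \<eta> = pmf (shift_left j m \<eta>) \<eta> * pmf S \<eta>"
        by (subst sum[of "{\<eta>}"]) auto
      also have "pmf (shift_left j m \<eta>) \<eta> = 1 - Q"
        using pmf_shift_left[of \<eta> m j 0] True by (simp add: pmf_shift_law_0 Q_def)
      finally show ?thesis using True Q by (simp add: S)
    next
      case False
      have self: "pmf (shift_left j m \<eta>) \<eta> = 1" using False by (simp add: shift_left_def)
      define L where "L = nat (height \<eta> (m + 1))"
      show ?thesis
      proof (cases "L = 0")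
        \<comment> \<open>Without particles up to m there is no orbit to receive from, and the
          density is already 1.\<close>
        case True
        have "\<xi> = \<eta>" if "\<eta> = (bubble m ^^ d) \<xi>" "d = 0 \<or> \<xi> m" "\<xi> \<in> S" for \<xi> d
        proof -
          have "False" if "\<xi> m"
            using supp(1)[OF \<open>\<xi> \<in> S\<close>] height_bubble_funpow[of \<xi>, where m = m and d = d] height_Suc[of \<xi> m]
              height_nonneg[of \<xi> m] that True \<open>\<eta> = _\<close> by (simp add: L_def)
          with that show ?thesis by auto
        qed
        then have "pmf (bind_pmf S (shift_left j m)) \<eta> = pmf S \<eta>"
          by (subst sum[of "{\<eta>}"]) (auto simp: self)
        moreover have "height \<eta> (m + 1) = 0" using True height_nonneg[OF A, of "m + 1"] by (simp add: L_def)
        then have "q ^ nat (int (Suc j) - height \<eta> (m + 1)) = Q"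
          by (simp only: Q_def diff_0_right nat_int)
        ultimately show ?thesis using False Q by (simp add: S)
      next
        case L: False
        obtain \<zeta> e where \<zeta>: "\<zeta> \<in> A_set" "\<zeta> m" "(bubble m ^^ e) \<zeta> = \<eta>"
          using bubble_funpow_preimage[OF A, of m] L by (auto simp: L_def)
        then obtain d where e: "e = Suc d" using False by (cases e) auto
        have ht: "nat (height \<zeta> (m + 1)) = L"
          using height_bubble_funpow[OF \<zeta>(1), where m = m and d = e] by (simp add: \<zeta>(3) L_def)
        have mass: "pmf (base (Suc j)) \<eta> = q ^ (L * Suc d) * pmf (base (Suc j)) \<zeta>"
          using pmf_base_bubble_funpow[OF m \<zeta>(1), of e] unfolding \<zeta>(3) ht by (simp only: e)
        have "\<zeta> \<noteq> \<eta>" using \<zeta>(2) False by auto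
        have "\<xi> \<in> {\<eta>, \<zeta>}" if "\<eta> = (bubble m ^^ d) \<xi>" "d = 0 \<or> \<xi> m" for \<xi> d
          using that bubble_funpow_eqD[of d m \<xi> e \<zeta>] \<zeta> by auto
        then have "pmf (bind_pmf S (shift_left j m)) \<eta> = (\<Sum>\<xi>\<in>{\<eta>, \<zeta>}. pmf (shift_left j m \<xi>) \<eta> * pmf S \<xi>)"
          by (intro sum) auto
        also have "\<dots> = pmf S \<eta> + pmf (shift_law j L) (Suc d) * pmf S \<zeta>"
          using pmf_shift_left[of \<zeta> m j e] \<zeta>(2) \<open>\<zeta> \<noteq> \<eta>\<close> by (simp add: self \<zeta>(3) ht flip: e)
        also have "pmf (shift_law j L) (Suc d) = Q * (q ^ (L * d) * (1 - q ^ L))"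
          using L by (simp add: pmf_shift_law_Suc Q_def)
        also have "pmf S \<zeta> = pmf (base (Suc j)) \<zeta> / (1 - Q)" using \<zeta>(2) by (simp add: S)
        also have "pmf S \<eta> = q ^ (L * Suc d) * pmf (base (Suc j)) \<zeta> *
            ((1 - q ^ nat (int (Suc j) - height \<eta> (m + 1))) / (1 - Q))"
          using False by (simp only: S mass if_False)
        also have "q ^ (L * Suc d) * pmf (base (Suc j)) \<zeta> *
            ((1 - q ^ nat (int (Suc j) - height \<eta> (m + 1))) / (1 - Q)) +
            Q * (q ^ (L * d) * (1 - q ^ L)) * (pmf (base (Suc j)) \<zeta> / (1 - Q)) =
            q ^ (L * Suc d) * pmf (base (Suc j)) \<zeta>"
        proof -
          have "height \<eta> (m + 1) \<le> height \<eta> (int j + 2)" using m by (intro height_mono[OF A]) simp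
          also have "\<dots> = int (Suc j)"
            using True height_full[of \<eta> "int (Suc j)" "int j + 2"] by simp
          finally have "Suc j = L + nat (int (Suc j) - height \<eta> (m + 1))"
            using height_nonneg[OF A, of "m + 1"] by (simp add: L_def)
          then have QL: "Q = q ^ L * q ^ nat (int (Suc j) - height \<eta> (m + 1))"
            unfolding Q_def by (metis power_add)
          \<comment> \<open>After clearing the denominator this is (1 - n) + n (1 - l) = 1 - l
            n.\<close>
          have alg: "a * l * b * ((1 - n) / (1 - l * n)) + (l * n) * (a * (1 - l)) * (b / (1 - l * n)) =
              a * l * b"
            if "l * n < 1" for a b l n :: real
            using that by (simp add: divide_simps) (simp add: algebra_simps)
          have "q ^ (L * Suc d) = q ^ (L * d) * q ^ L" by (simp add: power_add)
          with alg[of "q ^ L" "q ^ nat (int (Suc j) - height \<eta> (m + 1))"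
            "q ^ (L * d)" "pmf (base (Suc j)) \<zeta>"] Q
          show ?thesis unfolding QL by metis
        qed
        also have "\<dots> = pmf (base (Suc j)) \<eta>"
          by (rule mass[symmetric])
        finally show ?thesis .
      qed
    qed
  qed
  then show "pmf (bind_pmf (foldr T [m..int j] (base j)) (shift_left j m)) \<eta> = pmf (base (Suc j)) \<eta>"
    by (simp add: S_def)
qed

text \<open>The coupling pairs \<xi> with its random shift, which raises heights and leaves the
  sites beyond m alone.\<close>

lemma rel_pmf_partial_row:
  assumes m: "m \<le> int j + 1"
  shows "rel_pmf (height_le_eq_right m) (foldr T [m..int j] (base j)) (base (Suc j))"
proof -
  let ?S = "foldr T [m..int j] (base j)"
  have "rel_pmf (height_le_eq_right m) (bind_pmf ?S return_pmf) (bind_pmf ?S (shift_left j m))"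
  proof (rule rel_pmf_bindI[where R = "\<lambda>x y. x = y \<and> x \<in> set_pmf ?S"])
    show "rel_pmf (\<lambda>x y. x = y \<and> x \<in> set_pmf ?S) ?S ?S" by (rule rel_pmf_reflI) simp
    fix \<xi> \<eta> assume "\<xi> = \<eta> \<and> \<xi> \<in> set_pmf ?S"
    then have [simp]: "\<eta> = \<xi>" and \<xi>: "\<xi> \<in> A_set"
      using pmf_partial_row[OF m, of \<xi>] pmf_base_eq_0[of \<xi> "Suc j"] by (auto simp: set_pmf_iff)
    have "height_le_eq_right m \<xi> \<zeta>" if "\<zeta> \<in> set_pmf (shift_left j m \<xi>)" for \<zeta>
      using set_shift_left[OF that] \<xi>
      by (auto simp: height_le_eq_right_def height_le_def bubble_funpow_in_A height_bubble_funpow_le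
          bubble_funpow_right)
    then show "rel_pmf (height_le_eq_right m) (return_pmf \<xi>) (shift_left j m \<eta>)"
      by (simp add: rel_pmf_return_pmf1)
  qed
  then show ?thesis by (simp add: bind_return_pmf' bind_shift_left[OF m])
qed

text \<open>Without letters, \<pi> is coupled with its own truncation. Otherwise the first row is
  absorbed into \<open>base (Suc j)\<close>; the later rows act beyond m and preserve this coupling.
  The remaining word is shorter because m <= j.\<close>

lemma rel_pmf_growth:
  assumes "growth j w \<sigma>"
  shows "rel_pmf height_le (foldr T w (base j)) \<pi>"
  using assms
proof (induction "length w" arbitrary: j w \<sigma> rule: less_induct)
  case less
  show ?case
  proof (cases "w = []")
    case True
    have "rel_pmf (\<lambda>\<eta>. height_le (keep_rows j \<eta>)) \<pi> \<pi>"
      using support by (intro rel_pmf_reflI) (auto simp: height_le_def keep_rows_in_A height_keep_rows_le)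
    with True show ?thesis by (simp add: base_def pmf.rel_map)
  next
    case False
    obtain m v \<sigma>' where *: "m \<le> int j" "\<forall>k\<in>set v. m < k" "growth (Suc j) v \<sigma>'"
      "length w = length v + nat (int j + 1 - m)"
      "foldr T w (base j) = foldr T v (foldr T [m..int j] (base j))"
      using growth_first_row[OF less.prems] False by blast
    have "rel_pmf (height_le_eq_right m) (foldr T w (base j)) (foldr T v (base (Suc j)))"
      unfolding *(5) using *(1,2) by (intro rel_pmf_foldr_T rel_pmf_partial_row) auto
    moreover have "rel_pmf height_le (foldr T v (base (Suc j))) \<pi>"
      using *(1,4) by (intro less.hyps[OF _ *(3)]) auto
    ultimately have "rel_pmf (height_le_eq_right m OO height_le) (foldr T w (base j)) \<pi>"
      unfolding pmf.rel_compp by blast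
    then show ?thesis
      by (rule pmf.rel_mono_strong) (auto simp: height_le_eq_right_def height_le_def, meson order_trans)
  qed
qed

text \<open>Domination passes to mixtures because \<pi> is a mixture of itself.\<close>

lemma rel_pmf_growth_hull:
  assumes "growth_hull 0 (return_pmf (\<lambda>x. x > 0)) p"
  shows "rel_pmf height_le p \<pi>"
  using assms
proof (induction rule: growth_hull.induct)
  case (growth_hull_growth w \<sigma>)
  then show ?case using rel_pmf_growth[of 0 w \<sigma>] by (simp add: base_0)
next
  case (growth_hull_mix p1 p2 c)
  have "\<pi> = mix_pmf c \<pi> \<pi>" by (simp add: mix_pmf_def)
  moreover have "rel_pmf height_le (mix_pmf c p1 p2) (mix_pmf c \<pi> \<pi>)"
    unfolding mix_pmf_def
    by (rule rel_pmf_bindI[where R = "(=)"]) (use growth_hull_mix.IH in \<open>auto simp: pmf.rel_refl\<close>)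
  ultimately show ?case by simp
qed

lemma rel_pmf_foldr_op_pmf:
  assumes "0 < b2" "b2 \<le> 1"
  shows "rel_pmf height_le (foldr (op_pmf (q * b2) b2) ks (return_pmf (\<lambda>x. x > 0))) \<pi>"
proof (rule rel_pmf_growth_hull)
  let ?g = "return_pmf (\<lambda>x. x > 0) :: config pmf"
  have fixed: "T l ?g = ?g" if "l \<noteq> int 0" for l
    using T_base[OF that] by (simp add: base_0)
  show "growth_hull 0 ?g (foldr (op_pmf (q * b2) b2) ks ?g)"
  proof (induction ks)
    case Nil
    show ?case using growth_hull_growth[OF growth_Nil, of 0 ?g] by simp
  next
    case (Cons k ks)
    then show ?case using growth_hull_op_pmf[OF _ fixed assms] by simp
  qed
qed

end

section \<open>From mass functions to measures\<close>

text \<open>A mass function lives on the discrete sigma-algebra; this restricts its law to the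
  product sigma-algebra used for the measures in the theorem.\<close>

definition config_law :: "config pmf \<Rightarrow> config measure" where
  "config_law p = distr (measure_pmf p) config_space (\<lambda>\<eta>. \<eta>)"

lemma sets_config_law [simp]: "sets (config_law p) = sets config_space"
  by (simp add: config_law_def)

lemma emeasure_config_law: "S \<in> sets config_space \<Longrightarrow> emeasure (config_law p) S = emeasure (measure_pmf p) S"
  by (simp add: config_law_def emeasure_distr)

lemma prob_space_config_law: "prob_space (config_law p)"
  unfolding config_law_def by (rule measure_pmf.prob_space_distr) simp

lemma step_kernel_eq: "step_kernel b1 b2 k \<eta> = config_law (step_pmf b1 b2 k \<eta>)"
  unfolding step_kernel_def config_law_def step_pmf_def map_pmf_rep_eq
  by (subst distr_distr) (auto simp: comp_def)

lemma markov_op_config_law: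
  assumes "0 \<le> b1" "b1 \<le> 1" "0 \<le> b2" "b2 \<le> 1"
  shows "markov_op b1 b2 k (config_law p) = config_law (op_pmf b1 b2 k p)"
proof (rule measure_eqI)
  have sp: "space (config_law p) = UNIV" using sets_eq_imp_space_eq[OF sets_config_law] by simp
  have m: "step_kernel b1 b2 k \<in> config_law p \<rightarrow>\<^sub>M subprob_algebra config_space"
    using measurable_step_kernel[OF assms] measurable_cong_sets[OF sets_config_law refl] by blast
  show sets: "sets (markov_op b1 b2 k (config_law p)) = sets (config_law (op_pmf b1 b2 k p))"
    unfolding markov_op_def by (subst sets_bind[OF sets_kernel[OF m]]) (auto simp: sp)
  fix S assume "S \<in> sets (markov_op b1 b2 k (config_law p))"
  then have S: "S \<in> sets config_space" by (simp add: sets)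
  have [measurable]: "(\<lambda>\<eta>. emeasure (step_kernel b1 b2 k \<eta>) S) \<in> borel_measurable config_space"
    using measurable_emeasure_kernel[OF measurable_step_kernel[OF assms] S] .
  have "emeasure (markov_op b1 b2 k (config_law p)) S = (\<integral>\<^sup>+ \<eta>. emeasure (step_kernel b1 b2 k \<eta>) S \<partial>p)"
    unfolding emeasure_markov_op[OF assms sets_config_law S] unfolding config_law_def
    by (subst nn_integral_distr) auto
  also have "\<dots> = emeasure (config_law (op_pmf b1 b2 k p)) S"
    by (simp add: step_kernel_eq emeasure_config_law[OF S] op_pmf_def)
  finally show "emeasure (markov_op b1 b2 k (config_law p)) S = emeasure (config_law (op_pmf b1 b2 k p)) S" .
qed

lemma foldr_markov_op:
  assumes "0 \<le> b1" "b1 \<le> 1" "0 \<le> b2" "b2 \<le> 1"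
  shows "foldr (markov_op b1 b2) ks (return config_space \<eta>) =
    config_law (foldr (op_pmf b1 b2) ks (return_pmf \<eta>))"
proof (induction ks)
  case Nil
  show ?case
    by (rule measure_eqI) (auto simp: emeasure_config_law)
next
  case (Cons k ks)
  then show ?case by (simp add: markov_op_config_law[OF assms])
qed

lemma singleton_config_space [measurable]: "{\<eta>} \<in> sets config_space"
proof -
  have "{\<zeta> \<in> space config_space. \<forall>x. \<zeta> x = \<eta> x} \<in> sets config_space" by measurable
  also have "{\<zeta> \<in> space config_space. \<forall>x. \<zeta> x = \<eta> x} = {\<eta>}" by auto
  finally show ?thesis .
qed

text \<open>The image of the support is countable, hence measurable, and its complement is a null
  set containing all points where P fails.\<close>

lemma AE_distr_pmf:
  assumes "\<And>x. x \<in> set_pmf p \<Longrightarrow> P (f x)" "\<And>x. {f x} \<in> sets N"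
  shows "AE y in distr (measure_pmf p) N f. P y"
proof (rule AE_I)
  have sp: "f x \<in> space N" for x using sets.sets_into_space[OF assms(2)[of x]] by simp
  have C: "f ` set_pmf p \<in> sets N"
    by (rule sets.countable) (use assms(2) in auto)
  show "space N - f ` set_pmf p \<in> sets (distr (measure_pmf p) N f)" using C by auto
  show "emeasure (distr (measure_pmf p) N f) (space N - f ` set_pmf p) = 0"
    using C sp by (subst emeasure_distr) (auto simp: measure_pmf.emeasure_eq_measure measure_pmf_zero_iff)
  show "{y \<in> space (distr (measure_pmf p) N f). \<not> P y} \<subseteq> space N - f ` set_pmf p"
    using assms(1) by auto
qed

lemma stoch_dominated_config_law:
  assumes "rel_pmf height_le p p'"
  shows "config_law p \<preceq> config_law p'"
proof -
  obtain r where r: "\<And>x y. (x, y) \<in> set_pmf r \<Longrightarrow> height_le x y"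
    "map_pmf fst r = p" "map_pmf snd r = p'"
    using assms by (auto elim: rel_pmf.cases)
  have on_A: "prob_on_A (config_law s)" if "set_pmf s \<subseteq> A_set" for s
  proof -
    have "AE \<eta> in config_law s. \<eta> \<in> A_set"
      unfolding config_law_def by (rule AE_distr_pmf) (use that in auto)
    then show ?thesis by (simp add: prob_on_A_def prob_space_config_law)
  qed
  have sp: "space (config_space \<Otimes>\<^sub>M config_space) = UNIV" by (simp add: space_pair_measure)
  \<comment> \<open>The pair is reversed because \<open>stoch_dominated\<close> puts the dominating
    configuration first.\<close>
  define \<Gamma> where "\<Gamma> = distr (measure_pmf r) (config_space \<Otimes>\<^sub>M config_space) (\<lambda>x. (snd x, fst x))"
  have "prob_space \<Gamma>"
    unfolding \<Gamma>_def by (rule measure_pmf.prob_space_distr) (simp add: sp)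
  moreover have "distr \<Gamma> config_space fst = config_law p'" "distr \<Gamma> config_space snd = config_law p"
    unfolding \<Gamma>_def config_law_def r(2,3)[symmetric] map_pmf_rep_eq
    by (subst distr_distr; simp add: sp comp_def; subst distr_distr; simp add: comp_def)+
  moreover have "AE (\<eta>, \<xi>) in \<Gamma>. \<forall>x. height \<xi> x \<le> height \<eta> x"
    unfolding \<Gamma>_def
  proof (rule AE_distr_pmf)
    fix x assume "x \<in> set_pmf r"
    then show "case (snd x, fst x) of (\<eta>, \<xi>) \<Rightarrow> \<forall>x. height \<xi> x \<le> height \<eta> x"
      using r(1)[of "fst x" "snd x"] by (simp add: height_le_def)
  next
    fix x :: "config \<times> config"
    have "{snd x} \<times> {fst x} \<in> sets (config_space \<Otimes>\<^sub>M config_space)" by measurable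
    then show "{(snd x, fst x)} \<in> sets (config_space \<Otimes>\<^sub>M config_space)" by simp
  qed
  moreover have "set_pmf p \<subseteq> A_set" "set_pmf p' \<subseteq> A_set"
    using r(1) by (auto simp: height_le_def simp flip: r(2,3))
  ultimately show ?thesis
    unfolding stoch_dominated_def using on_A by (auto intro!: exI[of _ \<Gamma>]) (simp_all add: \<Gamma>_def)
qed

text \<open>Each configuration in A differs from the ground state at finitely many sites.
  Countability lets \<pi> be given by point masses.\<close>

lemma countable_A_set: "countable A_set"
proof (rule countable_subset)
  show "A_set \<subseteq> (\<lambda>F x. (x > 0) \<noteq> (x \<in> F)) ` {F. finite F}"
  proof
    fix \<eta> assume "\<eta> \<in> A_set"
    then have "finite ({x. x \<le> 0 \<and> \<eta> x} \<union> {x. 1 \<le> x \<and> \<not> \<eta> x})" by (simp add: A_set_iff)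
    moreover have "\<eta> = (\<lambda>x. (x > 0) \<noteq> (x \<in> {x. x \<le> 0 \<and> \<eta> x} \<union> {x. 1 \<le> x \<and> \<not> \<eta> x}))"
      by (auto simp: fun_eq_iff)
    ultimately show "\<eta> \<in> (\<lambda>F x. (x > 0) \<noteq> (x \<in> F)) ` {F. finite F}" by blast
  qed
  show "countable ((\<lambda>F x. (x > 0) \<noteq> (x \<in> F)) ` {F :: int set. finite F})"
    by (intro countable_image countable_Collect_finite)
qed

lemma A_set_sets [measurable]: "A_set \<in> sets config_space"
  by (rule sets.countable[OF _ countable_A_set]) measurable

section \<open>The blocking measure as a mass function\<close>

context asym
begin

definition site_pmf :: "int \<Rightarrow> bool pmf" where
  "site_pmf x = bernoulli_pmf (q powi (- x) / (1 + q powi (- x)))"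

lemma pmf_site_pmf:
  "pmf (site_pmf x) b = (if b then q powi (- x) else 1) / (1 + q powi (- x))"
proof -
  have "0 < q powi (- x)" using q by simp
  then have "0 \<le> q powi (- x) / (1 + q powi (- x))" "q powi (- x) / (1 + q powi (- x)) \<le> 1"
    "1 - q powi (- x) / (1 + q powi (- x)) = 1 / (1 + q powi (- x))"
    by (auto simp: field_simps)
  then show ?thesis unfolding site_pmf_def by (cases b) auto
qed

abbreviation product_measure :: "config measure" where
  "product_measure \<equiv> product_blocking_measure q"

lemma product_measure_eq: "product_measure = PiM UNIV (\<lambda>x. measure_pmf (site_pmf x))"
  by (simp add: product_blocking_measure_def site_pmf_def)

lemma sets_product_measure [simp, measurable_cong]: "sets product_measure = sets config_space"
  unfolding product_measure_eq config_space_def by (intro sets_PiM_cong) auto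

lemma space_product_measure [simp]: "space product_measure = UNIV"
  using sets_eq_imp_space_eq[OF sets_product_measure] by simp

sublocale site: product_prob_space "\<lambda>x. measure_pmf (site_pmf x)" UNIV
  by unfold_locales

lemma prob_space_product_measure: "prob_space product_measure"
  unfolding product_measure_eq by (rule site.P.prob_space_axioms)

lemma measure_product_measure_singleton:
  "(\<lambda>n. \<Prod>x\<in>{- int n..int n}. pmf (site_pmf x) (\<eta> x)) \<longlonglongrightarrow> measure product_measure {\<eta>}"
proof -
  interpret prob_space product_measure by (rule prob_space_product_measure)
  define B where "B n = {\<zeta>. \<forall>x\<in>{- int n..int n}. \<zeta> x = \<eta> x}" for n
  have B: "measure product_measure (B n) = (\<Prod>x\<in>{- int n..int n}. pmf (site_pmf x) (\<eta> x))" for n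
  proof -
    have "emeasure product_measure (B n) = (\<Prod>x\<in>{- int n..int n}. emeasure (measure_pmf (site_pmf x)) {\<eta> x})"
      using site.emeasure_PiM_Collect[of "{- int n..int n}" "\<lambda>x. {\<eta> x}"]
      by (simp add: B_def product_measure_eq space_PiM)
    then show ?thesis
      by (simp add: emeasure_eq_measure emeasure_pmf_single prod_ennreal prod_nonneg)
  qed
  have "{\<zeta> \<in> space config_space. \<forall>x\<in>{- int n..int n}. \<zeta> x = \<eta> x} \<in> sets config_space" for n
    by measurable
  then have "range B \<subseteq> sets product_measure" by (auto simp: B_def)
  moreover have "decseq B" by (auto simp: decseq_def B_def)
  ultimately have "(\<lambda>n. measure product_measure (B n)) \<longlonglongrightarrow> measure product_measure (\<Inter>n. B n)"
    by (intro finite_Lim_measure_decseq)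
  moreover have "(\<Inter>n. B n) = {\<eta>}"
  proof (intro equalityI subsetI)
    fix \<zeta> assume "\<zeta> \<in> (\<Inter>n. B n)"
    then have "\<zeta> \<in> B (nat \<bar>x\<bar>)" for x by blast
    then have agree: "\<forall>y\<in>{- int (nat \<bar>x\<bar>)..int (nat \<bar>x\<bar>)}. \<zeta> y = \<eta> y" for x
      by (simp only: B_def mem_Collect_eq)
    have "\<zeta> x = \<eta> x" for x by (rule bspec[OF agree[of x]]) auto
    then show "\<zeta> \<in> {\<eta>}" by auto
  qed (auto simp: B_def)
  ultimately show ?thesis by (simp add: B)
qed

text \<open>Once the window contains k and k + 1, the finite products differ by the ratio of the
  odds q^(-k) and q^(-(k+1)), which is q.\<close>

lemma measure_product_measure_swap:
  assumes "\<not> \<eta> k" "\<eta> (k + 1)"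
  shows "measure product_measure {swap_config k \<eta>} = q * measure product_measure {\<eta>}"
proof -
  let ?P = "\<lambda>\<eta> n. \<Prod>x\<in>{- int n..int n}. pmf (site_pmf x) (\<eta> x)"
  have P: "?P (swap_config k \<eta>) n = q * ?P \<eta> n" if "n \<ge> nat (\<bar>k\<bar> + 1)" for n
  proof -
    let ?I = "{- int n..int n}"
    have split: "?P \<zeta> n = pmf (site_pmf k) (\<zeta> k) * (pmf (site_pmf (k + 1)) (\<zeta> (k + 1)) *
        (\<Prod>x\<in>?I - {k} - {k + 1}. pmf (site_pmf x) (\<zeta> x)))" for \<zeta>
    proof -
      have "?P \<zeta> n = pmf (site_pmf k) (\<zeta> k) * (\<Prod>x\<in>?I - {k}. pmf (site_pmf x) (\<zeta> x))"
        using that by (intro prod.remove) auto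
      also have "(\<Prod>x\<in>?I - {k}. pmf (site_pmf x) (\<zeta> x)) = pmf (site_pmf (k + 1)) (\<zeta> (k + 1)) *
          (\<Prod>x\<in>?I - {k} - {k + 1}. pmf (site_pmf x) (\<zeta> x))"
        using that by (intro prod.remove) auto
      finally show ?thesis .
    qed
    have "(\<Prod>x\<in>?I - {k} - {k + 1}. pmf (site_pmf x) (swap_config k \<eta> x)) =
        (\<Prod>x\<in>?I - {k} - {k + 1}. pmf (site_pmf x) (\<eta> x))"
      by (intro prod.cong) (auto simp: swap_config_apply)
    moreover have "q powi (- k) = q * q powi (- (k + 1))"
      using q power_int_add[of q 1 "- (k + 1)"] by simp
    ultimately show ?thesis
      unfolding split using assms by (simp add: swap_config_apply pmf_site_pmf)
  qed
  have "eventually (\<lambda>n. q * ?P \<eta> n = ?P (swap_config k \<eta>) n) sequentially"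
    using eventually_ge_at_top[of "nat (\<bar>k\<bar> + 1)"] by eventually_elim (simp only: P)
  then have "?P (swap_config k \<eta>) \<longlonglongrightarrow> q * measure product_measure {\<eta>}"
    by (rule Lim_transform_eventually[rotated])
      (intro tendsto_mult tendsto_const measure_product_measure_singleton)
  with measure_product_measure_singleton show ?thesis by (rule LIMSEQ_unique)
qed

text \<open>Each factor is 1 / (1 + q^|x|) >= exp (- q^|x|), and the exponents are summable. This
  gives A positive mass, so that conditioning on it makes sense.\<close>

lemma measure_product_measure_ground_pos: "0 < measure product_measure {\<lambda>x. x > 0}"
proof -
  have "exp (- 2 / (1 - q)) \<le> (\<Prod>x\<in>{- int n..int n}. pmf (site_pmf x) (x > 0))" for n
  proof -
    have sum1: "(\<Sum>x\<in>{0..int n}. q ^ nat \<bar>x\<bar>) \<le> 1 / (1 - q)"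
    proof -
      have "(\<Sum>x\<in>{0..int n}. q ^ nat \<bar>x\<bar>) = (\<Sum>i\<in>{..n}. q ^ i)"
        by (rule sum.reindex_bij_witness[of _ int nat]) auto
      also have "\<dots> \<le> (\<Sum>i. q ^ i)" using q by (intro sum_le_suminf summable_geometric) auto
      finally show ?thesis using q by (simp add: suminf_geometric)
    qed
    have sum2: "(\<Sum>x\<in>{- int n..0}. q ^ nat \<bar>x\<bar>) = (\<Sum>x\<in>{0..int n}. q ^ nat \<bar>x\<bar>)"
      by (rule sum.reindex_bij_witness[of _ uminus uminus]) auto
    \<comment> \<open>Site 0 is counted twice on the right, which suffices for an upper
      bound.\<close>
    have "(\<Sum>x\<in>{- int n..int n}. q ^ nat \<bar>x\<bar>) \<le> (\<Sum>x\<in>{- int n..0} \<union> {0..int n}. q ^ nat \<bar>x\<bar>)"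
      using q by (intro sum_mono2) auto
    also have "\<dots> \<le> (\<Sum>x\<in>{- int n..0}. q ^ nat \<bar>x\<bar>) + (\<Sum>x\<in>{0..int n}. q ^ nat \<bar>x\<bar>)"
      using q by (subst sum_Un) (auto intro!: sum_nonneg)
    finally have "(\<Sum>x\<in>{- int n..int n}. q ^ nat \<bar>x\<bar>) \<le> 2 / (1 - q)" using sum1 sum2 by simp
    then have "exp (- 2 / (1 - q)) \<le> exp (- (\<Sum>x\<in>{- int n..int n}. q ^ nat \<bar>x\<bar>))" by simp
    also have "\<dots> = (\<Prod>x\<in>{- int n..int n}. exp (- (q ^ nat \<bar>x\<bar>)))"
      by (simp add: exp_sum flip: sum_negf)
    also have "\<dots> \<le> (\<Prod>x\<in>{- int n..int n}. pmf (site_pmf x) (x > 0))"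
    proof (rule prod_mono, rule conjI)
      fix x :: int
      have "pmf (site_pmf x) (x > 0) = 1 / (1 + q ^ nat \<bar>x\<bar>)"
        using q by (cases "x > 0")
          (auto simp: pmf_site_pmf power_int_def field_simps)
      moreover have "1 + q ^ nat \<bar>x\<bar> \<le> exp (q ^ nat \<bar>x\<bar>)" by (rule exp_ge_add_one_self)
      moreover have "0 < 1 + q ^ nat \<bar>x\<bar>" using q by (simp add: add_pos_pos)
      ultimately show "exp (- (q ^ nat \<bar>x\<bar>)) \<le> pmf (site_pmf x) (x > 0)"
        unfolding exp_minus inverse_eq_divide by (simp only:) (intro divide_left_mono, auto)
    qed simp
    finally show ?thesis .
  qed
  then have "exp (- 2 / (1 - q)) \<le> measure product_measure {\<lambda>x. x > 0}"
    by (intro LIMSEQ_le_const[OF measure_product_measure_singleton]) blast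
  then show ?thesis by (rule less_le_trans[OF exp_gt_zero])
qed

lemma emeasure_A_set_pos: "emeasure product_measure A_set \<noteq> 0" "emeasure product_measure A_set \<noteq> \<infinity>"
proof -
  interpret prob_space product_measure by (rule prob_space_product_measure)
  have "measure product_measure {\<lambda>x. x > 0} \<le> measure product_measure A_set"
    using ground_A by (intro finite_measure_mono) auto
  then show "emeasure product_measure A_set \<noteq> 0"
    using measure_product_measure_ground_pos by (simp add: emeasure_eq_measure)
  show "emeasure product_measure A_set \<noteq> \<infinity>" by (simp add: emeasure_eq_measure)
qed

definition blocking_pmf :: "config pmf" where
  "blocking_pmf = embed_pmf (\<lambda>\<eta>. measure (blocking_measure q) {\<eta>})"

lemma prob_space_blocking_measure: "prob_space (blocking_measure q)"
  unfolding blocking_measure_def by (rule prob_space_uniform_measure) (fact emeasure_A_set_pos)+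

lemma sets_blocking_measure [simp]: "sets (blocking_measure q) = sets config_space"
  by (simp add: blocking_measure_def)

lemma emeasure_blocking_measure_A: "emeasure (blocking_measure q) A_set = 1"
  unfolding blocking_measure_def by (rule emeasure_uniform_measure_1) (fact emeasure_A_set_pos)+

lemma measure_blocking_measure_singleton:
  "measure (blocking_measure q) {\<eta>} =
     (if \<eta> \<in> A_set then measure product_measure {\<eta>} / measure product_measure A_set else 0)"
  unfolding blocking_measure_def by (subst measure_uniform_measure) (use emeasure_A_set_pos in auto)

text \<open>The point masses add up to 1 because the measure is concentrated on the countable set
  A.\<close>

lemma pmf_blocking_pmf: "pmf blocking_pmf \<eta> = measure (blocking_measure q) {\<eta>}"
  unfolding blocking_pmf_def
proof (rule pmf_embed_pmf)
  interpret prob_space "blocking_measure q" by (rule prob_space_blocking_measure)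
  have "(\<integral>\<^sup>+ \<eta>. ennreal (measure (blocking_measure q) {\<eta>}) \<partial>count_space UNIV) =
      (\<integral>\<^sup>+ \<eta>. emeasure (blocking_measure q) {\<eta>} \<partial>count_space A_set)"
    unfolding emeasure_eq_measure
    by (rule nn_integral_count_space_eq) (auto simp: measure_blocking_measure_singleton)
  also have "\<dots> = emeasure (blocking_measure q) A_set"
    by (rule emeasure_countable_singleton[symmetric]) (auto simp: countable_A_set)
  finally show "(\<integral>\<^sup>+ \<eta>. ennreal (measure (blocking_measure q) {\<eta>}) \<partial>count_space UNIV) = 1"
    by (simp add: emeasure_blocking_measure_A)
qed simp

sublocale blocking q blocking_pmf
proof
  show "set_pmf blocking_pmf \<subseteq> A_set"
    by (auto simp: set_pmf_iff pmf_blocking_pmf measure_blocking_measure_singleton split: if_splits)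
  show "balanced k (pmf blocking_pmf)" for k
    unfolding balanced_def pmf_blocking_pmf measure_blocking_measure_singleton
    by (simp add: measure_product_measure_swap)
qed

lemma config_law_blocking_pmf: "config_law blocking_pmf = blocking_measure q"
proof (rule measure_eqI)
  interpret prob_space "blocking_measure q" by (rule prob_space_blocking_measure)
  fix S assume "S \<in> sets (config_law blocking_pmf)"
  then have S [measurable]: "S \<in> sets config_space" by simp
  have "AE \<eta> in blocking_measure q. \<eta> \<in> A_set"
    using emeasure_blocking_measure_A by (intro AE_prob_1) (simp add: measure_def)
  then have "emeasure (blocking_measure q) S = emeasure (blocking_measure q) (S \<inter> A_set)"
    by (intro emeasure_eq_AE) auto
  also have "\<dots> = (\<integral>\<^sup>+ \<eta>. emeasure (blocking_measure q) {\<eta>} \<partial>count_space (S \<inter> A_set))"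
    by (rule emeasure_countable_singleton) (auto intro: countable_subset[OF _ countable_A_set])
  also have "\<dots> = (\<integral>\<^sup>+ \<eta>. pmf blocking_pmf \<eta> \<partial>count_space S)"
    unfolding emeasure_eq_measure pmf_blocking_pmf
    by (rule nn_integral_count_space_eq) (auto simp: measure_blocking_measure_singleton)
  also have "\<dots> = emeasure (config_law blocking_pmf) S"
    by (simp add: nn_integral_pmf emeasure_config_law)
  finally show "emeasure (config_law blocking_pmf) S = emeasure (blocking_measure q) S" ..
qed simp

end

theorem theorem2p6:
  fixes b1 b2 :: real and ks :: "int list"
  assumes "0 < b1" and "b1 < b2" and "b2 < 1"
  shows "foldr (markov_op b1 b2) ks (return config_space (\<lambda>x. x > 0)) \<preceq> blocking_measure (b1 / b2)"
proof -
  interpret asym "b1 / b2" using assms by unfold_locales auto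
  \<comment> \<open>Brings \<open>b1\<close> into the form \<open>q * b2\<close> with q = b1 /
    b2.\<close>
  have "b1 = b1 / b2 * b2" using assms by simp
  then have "rel_pmf height_le (foldr (op_pmf b1 b2) ks (return_pmf (\<lambda>x. x > 0))) blocking_pmf"
    using rel_pmf_foldr_op_pmf[of b2 ks] assms by simp
  then have "config_law (foldr (op_pmf b1 b2) ks (return_pmf (\<lambda>x. x > 0))) \<preceq> config_law blocking_pmf"
    by (rule stoch_dominated_config_law)
  then show ?thesis
    using assms by (simp add: foldr_markov_op config_law_blocking_pmf)
qed

end
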